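(* If $N:\langle\Gamma\vdash U\rangle$ is derivable and $M\rhd^*_\beta N$, then $M:\langle\Gamma\uparrow^M\vdash U\rangle$ is derivable.
   Context: Indexes: finite sequences of natural numbers ($\mathcal L_{\mathbb N}$), $\oslash$ empty, $i::L$ prepending $i$, $L_1\preceq L_2$ (also $L_2\succeq L_1$) iff $L_2=L_1::L_3$ for some $L_3$ (concatenation). Terms: over a countably infinite set $\mathcal V$, terms $\mathcal M$, free indexed variables $\mathrm{fv}$, degree $d$, joinability $\diamond$ defined simultaneously: $x^L\in\mathcal M$ ($\mathrm{fv}=\{x^L\}$, $d=L$); $MN\in\mathcal M$ when $d(M)\preceq d(N)$, $M\diamond N$ ($\mathrm{fv}$ union, $d(MN)=d(M)$); $\lambda x^L.M\in\mathcal M$ when $L\succeq d(M)$ ($\mathrm{fv}(M)\setminus\{x^L\}$, $d=d(M)$). $M\diamond N$ iff $x^L\in\mathrm{fv}(M)$, $x^K\in\mathrm{fv}(N)$ imply $L=K$. Terms modulo $\alpha$; $M[x^L:=N]$ defined only if $M\diamond N$ and $d(N)=L$. $\rhd_\beta$: least relation compatible with abstraction and application containing $(\lambda x^L.M)N\rhd_\beta M[x^L:=N]$ ($d(N)=L$); $\rhd^*_\beta$ its reflexive–transitive closure. Lifting $(x^L)^{+i}=x^{i::L}$, $(M_1M_2)^{+i}=M_1^{+i}M_2^{+i}$, $(\lambda x^L.M)^{+i}=\lambda x^{i::L}.M^{+i}$. Types: atomic types $\mathcal A$, expansion variables $\overline e_0,\overline e_1,\dots$; $\mathbb T\subseteq\mathbb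 U$ with degree: $a\in\mathbb T$ ($d=\oslash$); $U\to T\in\mathbb T$ for $U\in\mathbb U,T\in\mathbb T$ ($d=\oslash$); $\omega^L\in\mathbb U$ ($d=L$); $U_1\sqcap U_2$ if $d(U_1)=d(U_2)$; $\overline e_iU$ ($d=i::d(U)$); modulo $\sqcap$ commutative, associative, idempotent, $\overline e_i(U_1\sqcap U_2)=\overline e_iU_1\sqcap\overline e_iU_2$, $\omega^L\sqcap U=U$ ($d(U)=L$), $\overline e_i\omega^K=\omega^{i::K}$. Environments: finite sets of declarations $x^L:U$ (at most one per $x^L$); $\Gamma,\Delta$ disjoint union; $env^\omega_M$ assigns $\omega^L$ to each $x^L\in\mathrm{fv}(M)$; $\Gamma_1\sqcap\Gamma_2$ intersects types of common variables, keeps others; $\overline e_j\Gamma$ replaces $x^L:U$ by $x^{j::L}:\overline e_jU$; $\Gamma_1\diamond\Gamma_2$ iff $x^L\in\mathrm{dom}\,\Gamma_1$, $x^K\in\mathrm{dom}\,\Gamma_2$ imply $L=K$. If $\mathrm{dom}\,\Gamma\subseteq\mathrm{fv}(M)$, $\Gamma\uparrow^M$ is $\Gamma$ extended with $x^L:\omega^L$ for each $x^L\in\mathrm{fv}(M)\setminus\mathrm{dom}\,\Gamma$. Subtyping $\sqsubseteq$: least relation on types, environments and typings closed under reflexivity, transitivity, $U_1\sqcap U_2\sqsubseteq U_1$ ($d(U_1)=d(U_2)$), $U_1\sqcap U_2\sqsubseteq V_1\sqcap V_2$ if $U_i\sqsubseteq V_i$, $U_1\to T_1\sqsubseteq U_2\to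 T_2$ if $U_2\sqsubseteq U_1$, $T_1\sqsubseteq T_2$, $\overline e_iU_1\sqsubseteq\overline e_iU_2$ if $U_1\sqsubseteq U_2$, $\Gamma,y^L:U_1\sqsubseteq\Gamma,y^L:U_2$ if $U_1\sqsubseteq U_2$, $\langle\Gamma_1\vdash U_1\rangle\sqsubseteq\langle\Gamma_2\vdash U_2\rangle$ if $U_1\sqsubseteq U_2$, $\Gamma_2\sqsubseteq\Gamma_1$. Typing rules ($T\in\mathbb T$): (ax) $x^\oslash:\langle(x^\oslash:T)\vdash T\rangle$; ($\omega$) $M:\langle env^\omega_M\vdash\omega^{d(M)}\rangle$; ($\to_I$) $M:\langle\Gamma,(x^L:U)\vdash T\rangle\Rightarrow\lambda x^L.M:\langle\Gamma\vdash U\to T\rangle$; ($\to'_I$) $M:\langle\Gamma\vdash T\rangle$, $x^L\notin\mathrm{dom}\,\Gamma\Rightarrow\lambda x^L.M:\langle\Gamma\vdash\omega^L\to T\rangle$; ($\to_E$) $M_1:\langle\Gamma_1\vdash U\to T\rangle$, $M_2:\langle\Gamma_2\vdash U\rangle$, $\Gamma_1\diamond\Gamma_2\Rightarrow M_1M_2:\langle\Gamma_1\sqcap\Gamma_2\vdash T\rangle$; ($\sqcap_I$) $M:\langle\Gamma\vdash U_1\rangle$, $M:\langle\Gamma\vdash U_2\rangle\Rightarrow M:\langle\Gamma\vdash U_1\sqcap U_2\rangle$; ($e$) $M:\langle\Gamma\vdash U\rangle\Rightarrow M^{+j}:\langle\overline e_j\Gamma\vdash\overline e_jU\rangle$; ($\sqsubseteq$)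 $M:\langle\Gamma\vdash U\rangle$, $\langle\Gamma\vdash U\rangle\sqsubseteq\langle\Gamma'\vdash U'\rangle\Rightarrow M:\langle\Gamma'\vdash U'\rangle$. *)

theory Defs
  imports Main "HOL-Library.Sublist" "HOL-Library.Countable" "HOL-Library.Infinite_Typeclass"
begin

type_synonym index = "nat list"

type_synonym 'v ivar = "'v \<times> index"

definition joinable :: "'v ivar set \<Rightarrow> 'v ivar set \<Rightarrow> bool" where
  "joinable A B \<longleftrightarrow> (\<forall>x L K. (x, L) \<in> A \<longrightarrow> (x, K) \<in> B \<longrightarrow> L = K)"


section \<open>Terms\<close>

text \<open>
  Terms modulo \<open>\<alpha>\<close> are represented in locally nameless style: only bound variables are
  nameless, and \<open>Abs x L M\<close> below is the named abstraction \<open>\<lambda>x\<^sup>L. M\<close>, so that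
  \<open>\<alpha>\<close>-equivalence is equality. Every occurrence of a variable, free or bound, carries its index.
  The datatype contains junk (dangling or wrongly annotated bound variables, violated degree or
  joinability conditions); the actual terms are the elements of the set \<open>terms\<close>.
\<close>

datatype 'v trm =
    Bnd nat index
  | Var 'v index
  | App "'v trm" "'v trm"
  | Lam index "'v trm"

primrec close :: "nat \<Rightarrow> 'v \<Rightarrow> index \<Rightarrow> 'v trm \<Rightarrow> 'v trm" where
  "close k x L (Bnd n K) = Bnd n K"
| "close k x L (Var y K) = (if y = x \<and> K = L then Bnd k L else Var y K)"
| "close k x L (App M N) = App (close k x L M) (close k x L N)"
| "close k x L (Lam K M) = Lam K (close (Suc k) x L M)"

definition Abs :: "'v \<Rightarrow> index \<Rightarrow> 'v trm \<Rightarrow> 'v trm" where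
  "Abs x L M = Lam L (close 0 x L M)"

primrec fv :: "'v trm \<Rightarrow> 'v ivar set" where
  "fv (Bnd n K) = {}"
| "fv (Var x L) = {(x, L)}"
| "fv (App M N) = fv M \<union> fv N"
| "fv (Lam L M) = fv M"

primrec deg :: "'v trm \<Rightarrow> index" where
  "deg (Bnd n K) = K"
| "deg (Var x L) = L"
| "deg (App M N) = deg M"
| "deg (Lam L M) = deg M"

abbreviation tjoin :: "'v trm \<Rightarrow> 'v trm \<Rightarrow> bool" (infix "\<diamondop>" 50) where
  "M \<diamondop> N \<equiv> joinable (fv M) (fv N)"

inductive_set "terms" :: "'v trm set" where
  var: "Var x L \<in> terms"
| app: "\<lbrakk>M \<in> terms; N \<in> terms; prefix (deg M) (deg N); M \<diamondop> N\<rbrakk> \<Longrightarrow> App M N \<in> terms"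
| abs: "\<lbrakk>M \<in> terms; prefix (deg M) L\<rbrakk> \<Longrightarrow> Abs x L M \<in> terms"

text \<open>\<open>subst x L N M\<close> is \<open>M[x\<^sup>L := N]\<close>; it is only used under the conditions that make
  the latter defined.\<close>

primrec subst :: "'v \<Rightarrow> index \<Rightarrow> 'v trm \<Rightarrow> 'v trm \<Rightarrow> 'v trm" where
  "subst x L N (Bnd n K) = Bnd n K"
| "subst x L N (Var y K) = (if y = x \<and> K = L then N else Var y K)"
| "subst x L N (App M M') = App (subst x L N M) (subst x L N M')"
| "subst x L N (Lam K M) = Lam K (subst x L N M)"

primrec lift :: "nat \<Rightarrow> 'v trm \<Rightarrow> 'v trm" where
  "lift i (Bnd n K) = Bnd n (i # K)"
| "lift i (Var x L) = Var x (i # L)"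
| "lift i (App M N) = App (lift i M) (lift i N)"
| "lift i (Lam L M) = Lam (i # L) (lift i M)"

text \<open>The following equations are the defining clauses for named abstractions.\<close>

lemma fv_close: "fv (close k x L M) = fv M - {(x, L)}"
  by (induction M arbitrary: k) auto

lemma fv_Abs: "fv (Abs x L M) = fv M - {(x, L)}"
  by (simp add: Abs_def fv_close)

lemma deg_close: "deg (close k x L M) = deg M"
  by (induction M arbitrary: k) auto

lemma deg_Abs: "deg (Abs x L M) = deg M"
  by (simp add: Abs_def deg_close)

lemma lift_close: "lift i (close k x L M) = close k x (i # L) (lift i M)"
  by (induction M arbitrary: k) auto

lemma lift_Abs: "lift i (Abs x L M) = Abs x (i # L) (lift i M)"
  by (simp add: Abs_def lift_close)

lemma close_fresh: "(x, L) \<notin> fv M \<Longrightarrow> close k x L M = M"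
  by (induction M arbitrary: k) auto

lemma subst_close:
  "\<lbrakk>(y, K) \<noteq> (x, L); (y, K) \<notin> fv N\<rbrakk> \<Longrightarrow> subst x L N (close k y K M) = close k y K (subst x L N M)"
  by (induction M arbitrary: k) (auto simp: close_fresh)

lemma subst_Abs:
  "\<lbrakk>(y, K) \<noteq> (x, L); (y, K) \<notin> fv N\<rbrakk> \<Longrightarrow> subst x L N (Abs y K M) = Abs y K (subst x L N M)"
  by (simp add: Abs_def subst_close)

lemma close_alpha: "(y, L) \<notin> fv M \<Longrightarrow> close k x L M = close k y L (subst x L (Var y L) M)"
  by (induction M arbitrary: k) auto

lemma Abs_alpha: "(y, L) \<notin> fv M \<Longrightarrow> Abs x L M = Abs y L (subst x L (Var y L) M)"
  by (simp add: Abs_def close_alpha)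

inductive beta :: "'v trm \<Rightarrow> 'v trm \<Rightarrow> bool" (infix "\<rhd>\<^sub>\<beta>" 50) where
  redex: "\<lbrakk>M \<in> terms; N \<in> terms; App (Abs x L M) N \<in> terms; deg N = L; M \<diamondop> N\<rbrakk>
    \<Longrightarrow> App (Abs x L M) N \<rhd>\<^sub>\<beta> subst x L N M"
| abs: "\<lbrakk>M \<rhd>\<^sub>\<beta> N; Abs x L M \<in> terms; Abs x L N \<in> terms\<rbrakk> \<Longrightarrow> Abs x L M \<rhd>\<^sub>\<beta> Abs x L N"
| appL: "\<lbrakk>M \<rhd>\<^sub>\<beta> N; App M P \<in> terms; App N P \<in> terms\<rbrakk> \<Longrightarrow> App M P \<rhd>\<^sub>\<beta> App N P"
| appR: "\<lbrakk>M \<rhd>\<^sub>\<beta> N; App P M \<in> terms; App P N \<in> terms\<rbrakk> \<Longrightarrow> App P M \<rhd>\<^sub>\<beta> App P N"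

abbreviation betas :: "'v trm \<Rightarrow> 'v trm \<Rightarrow> bool" (infix "\<rhd>\<^sub>\<beta>\<^sup>*" 50) where
  "M \<rhd>\<^sub>\<beta>\<^sup>* N \<equiv> beta\<^sup>*\<^sup>* M N"


section \<open>Types\<close>

datatype 'a rty =
    RAtom 'a
  | RArrow "'a rty" "'a rty"
  | ROmega index
  | RInter "'a rty" "'a rty"
  | RExp nat "'a rty"

primrec rdeg :: "'a rty \<Rightarrow> index" where
  "rdeg (RAtom a) = []"
| "rdeg (RArrow U T) = []"
| "rdeg (ROmega L) = L"
| "rdeg (RInter U V) = rdeg U"
| "rdeg (RExp i U) = i # rdeg U"

inductive teq :: "'a rty \<Rightarrow> 'a rty \<Rightarrow> bool" where
  refl: "teq U U"
| sym: "teq U V \<Longrightarrow> teq V U"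
| trans: "\<lbrakk>teq U V; teq V W\<rbrakk> \<Longrightarrow> teq U W"
| arrow: "\<lbrakk>teq U U'; teq T T'\<rbrakk> \<Longrightarrow> teq (RArrow U T) (RArrow U' T')"
| inter: "\<lbrakk>teq U U'; teq V V'\<rbrakk> \<Longrightarrow> teq (RInter U V) (RInter U' V')"
| exp: "teq U U' \<Longrightarrow> teq (RExp i U) (RExp i U')"
| comm: "rdeg U = rdeg V \<Longrightarrow> teq (RInter U V) (RInter V U)"
| assoc: "\<lbrakk>rdeg U = rdeg V; rdeg V = rdeg W\<rbrakk>
    \<Longrightarrow> teq (RInter (RInter U V) W) (RInter U (RInter V W))"
| idem: "teq (RInter U U) U"
| exp_inter: "rdeg U = rdeg V \<Longrightarrow> teq (RExp i (RInter U V)) (RInter (RExp i U) (RExp i V))"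
| omega_inter: "rdeg U = L \<Longrightarrow> teq (RInter (ROmega L) U) U"
| exp_omega: "teq (RExp i (ROmega K)) (ROmega (i # K))"

lemma teq_rdeg: "teq U V \<Longrightarrow> rdeg U = rdeg V"
  by (induction rule: teq.induct) auto

text \<open>The quotient still contains ill-formed classes, such as intersections of types of different
  degrees; the actual types are the elements of \<open>UU\<close> and \<open>TT\<close> below.\<close>

quotient_type 'a ty = "'a rty" / teq
  by (rule equivpI) (auto intro: reflpI sympI transpI teq.refl teq.sym teq.trans)

lift_definition Atom :: "'a \<Rightarrow> 'a ty" is RAtom .

lift_definition Arrow :: "'a ty \<Rightarrow> 'a ty \<Rightarrow> 'a ty" is RArrow by (rule teq.arrow)

lift_definition Omega :: "index \<Rightarrow> 'a ty" is ROmega .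

lift_definition Inter :: "'a ty \<Rightarrow> 'a ty \<Rightarrow> 'a ty" is RInter by (rule teq.inter)

lift_definition Exp :: "nat \<Rightarrow> 'a ty \<Rightarrow> 'a ty" is RExp by (rule teq.exp)

lift_definition tdeg :: "'a ty \<Rightarrow> index" is rdeg by (rule teq_rdeg)

inductive_set TT :: "'a ty set" and UU :: "'a ty set" where
  atom: "Atom a \<in> TT"
| arrow: "\<lbrakk>U \<in> UU; T \<in> TT\<rbrakk> \<Longrightarrow> Arrow U T \<in> TT"
| TT_UU: "T \<in> TT \<Longrightarrow> T \<in> UU"
| omega: "Omega L \<in> UU"
| inter: "\<lbrakk>U \<in> UU; V \<in> UU; tdeg U = tdeg V\<rbrakk> \<Longrightarrow> Inter U V \<in> UU"
| exp: "U \<in> UU \<Longrightarrow> Exp i U \<in> UU"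


section \<open>Environments\<close>

type_synonym ('v, 'a) env = "'v ivar \<rightharpoonup> 'a ty"

definition wf_env :: "('v, 'a) env \<Rightarrow> bool" where
  "wf_env \<Gamma> \<longleftrightarrow> finite (dom \<Gamma>) \<and> ran \<Gamma> \<subseteq> UU"

definition env_omega :: "'v trm \<Rightarrow> ('v, 'a) env" where
  "env_omega M = (\<lambda>(x, L). if (x, L) \<in> fv M then Some (Omega L) else None)"

definition env_inter :: "('v, 'a) env \<Rightarrow> ('v, 'a) env \<Rightarrow> ('v, 'a) env" where
  "env_inter \<Gamma>\<^sub>1 \<Gamma>\<^sub>2 = (\<lambda>v. case (\<Gamma>\<^sub>1 v, \<Gamma>\<^sub>2 v) of
      (Some U, Some V) \<Rightarrow> Some (Inter U V)
    | (Some U, None) \<Rightarrow> Some U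
    | (None, r) \<Rightarrow> r)"

definition env_exp :: "nat \<Rightarrow> ('v, 'a) env \<Rightarrow> ('v, 'a) env" where
  "env_exp j \<Gamma> = (\<lambda>(x, K). case K of
      [] \<Rightarrow> None
    | i # L \<Rightarrow> if i = j then map_option (Exp j) (\<Gamma> (x, L)) else None)"

abbreviation env_join :: "('v, 'a) env \<Rightarrow> ('v, 'a) env \<Rightarrow> bool" where
  "env_join \<Gamma>\<^sub>1 \<Gamma>\<^sub>2 \<equiv> joinable (dom \<Gamma>\<^sub>1) (dom \<Gamma>\<^sub>2)"

text \<open>\<open>env_up \<Gamma> M\<close> is \<open>\<Gamma>\<up>\<^sup>M\<close>, for \<open>dom \<Gamma> \<subseteq> fv M\<close>; \<open>++\<close> gives priority to \<open>\<Gamma>\<close>.\<close>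

definition env_up :: "('v, 'a) env \<Rightarrow> 'v trm \<Rightarrow> ('v, 'a) env" where
  "env_up \<Gamma> M = env_omega M ++ \<Gamma>"


section \<open>Subtyping\<close>

inductive sub :: "'a ty \<Rightarrow> 'a ty \<Rightarrow> bool" (infix "\<sqsubseteq>" 50) where
  refl: "U \<in> UU \<Longrightarrow> U \<sqsubseteq> U"
| trans: "\<lbrakk>U \<sqsubseteq> V; V \<sqsubseteq> W\<rbrakk> \<Longrightarrow> U \<sqsubseteq> W"
| inter_elim: "\<lbrakk>U\<^sub>1 \<in> UU; U\<^sub>2 \<in> UU; tdeg U\<^sub>1 = tdeg U\<^sub>2\<rbrakk> \<Longrightarrow> Inter U\<^sub>1 U\<^sub>2 \<sqsubseteq> U\<^sub>1"
| inter: "\<lbrakk>U\<^sub>1 \<sqsubseteq> V\<^sub>1; U\<^sub>2 \<sqsubseteq> V\<^sub>2; tdeg U\<^sub>1 = tdeg U\<^sub>2; tdeg V\<^sub>1 = tdeg V\<^sub>2\<rbrakk>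
    \<Longrightarrow> Inter U\<^sub>1 U\<^sub>2 \<sqsubseteq> Inter V\<^sub>1 V\<^sub>2"
| arrow: "\<lbrakk>U\<^sub>2 \<sqsubseteq> U\<^sub>1; T\<^sub>1 \<sqsubseteq> T\<^sub>2; T\<^sub>1 \<in> TT; T\<^sub>2 \<in> TT\<rbrakk> \<Longrightarrow> Arrow U\<^sub>1 T\<^sub>1 \<sqsubseteq> Arrow U\<^sub>2 T\<^sub>2"
| exp: "U\<^sub>1 \<sqsubseteq> U\<^sub>2 \<Longrightarrow> Exp i U\<^sub>1 \<sqsubseteq> Exp i U\<^sub>2"

inductive sub_env :: "('v, 'a) env \<Rightarrow> ('v, 'a) env \<Rightarrow> bool" where
  refl: "wf_env \<Gamma> \<Longrightarrow> sub_env \<Gamma> \<Gamma>"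
| trans: "\<lbrakk>sub_env \<Gamma>\<^sub>1 \<Gamma>\<^sub>2; sub_env \<Gamma>\<^sub>2 \<Gamma>\<^sub>3\<rbrakk> \<Longrightarrow> sub_env \<Gamma>\<^sub>1 \<Gamma>\<^sub>3"
| decl: "\<lbrakk>wf_env \<Gamma>; (y, L) \<notin> dom \<Gamma>; U\<^sub>1 \<sqsubseteq> U\<^sub>2\<rbrakk>
    \<Longrightarrow> sub_env (\<Gamma>((y, L) \<mapsto> U\<^sub>1)) (\<Gamma>((y, L) \<mapsto> U\<^sub>2))"

inductive sub_typing :: "('v, 'a) env \<times> 'a ty \<Rightarrow> ('v, 'a) env \<times> 'a ty \<Rightarrow> bool" where
  refl: "\<lbrakk>wf_env \<Gamma>; U \<in> UU\<rbrakk> \<Longrightarrow> sub_typing (\<Gamma>, U) (\<Gamma>, U)"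
| trans: "\<lbrakk>sub_typing \<Phi>\<^sub>1 \<Phi>\<^sub>2; sub_typing \<Phi>\<^sub>2 \<Phi>\<^sub>3\<rbrakk> \<Longrightarrow> sub_typing \<Phi>\<^sub>1 \<Phi>\<^sub>3"
| pair: "\<lbrakk>U\<^sub>1 \<sqsubseteq> U\<^sub>2; sub_env \<Gamma>\<^sub>2 \<Gamma>\<^sub>1\<rbrakk> \<Longrightarrow> sub_typing (\<Gamma>\<^sub>1, U\<^sub>1) (\<Gamma>\<^sub>2, U\<^sub>2)"


section \<open>Typing\<close>

inductive typing :: "'v trm \<Rightarrow> ('v, 'a) env \<Rightarrow> 'a ty \<Rightarrow> bool"
    ("(_ \<Colon> \<langle>_ \<turnstile> _\<rangle>)" [51, 51, 51] 50) where
  ax: "T \<in> TT \<Longrightarrow> Var x [] \<Colon> \<langle>[(x, []) \<mapsto> T] \<turnstile> T\<rangle>"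
| omega: "M \<in> terms \<Longrightarrow> M \<Colon> \<langle>env_omega M \<turnstile> Omega (deg M)\<rangle>"
| arrI: "\<lbrakk>M \<Colon> \<langle>\<Gamma>((x, L) \<mapsto> U) \<turnstile> T\<rangle>; (x, L) \<notin> dom \<Gamma>; T \<in> TT\<rbrakk>
    \<Longrightarrow> Abs x L M \<Colon> \<langle>\<Gamma> \<turnstile> Arrow U T\<rangle>"
| arrI': "\<lbrakk>M \<Colon> \<langle>\<Gamma> \<turnstile> T\<rangle>; (x, L) \<notin> dom \<Gamma>; T \<in> TT\<rbrakk>
    \<Longrightarrow> Abs x L M \<Colon> \<langle>\<Gamma> \<turnstile> Arrow (Omega L) T\<rangle>"
| arrE: "\<lbrakk>M\<^sub>1 \<Colon> \<langle>\<Gamma>\<^sub>1 \<turnstile> Arrow U T\<rangle>; M\<^sub>2 \<Colon> \<langle>\<Gamma>\<^sub>2 \<turnstile> U\<rangle>; env_join \<Gamma>\<^sub>1 \<Gamma>\<^sub>2; U \<in> UU; T \<in> TT\<rbrakk>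
    \<Longrightarrow> App M\<^sub>1 M\<^sub>2 \<Colon> \<langle>env_inter \<Gamma>\<^sub>1 \<Gamma>\<^sub>2 \<turnstile> T\<rangle>"
| interI: "\<lbrakk>M \<Colon> \<langle>\<Gamma> \<turnstile> U\<^sub>1\<rangle>; M \<Colon> \<langle>\<Gamma> \<turnstile> U\<^sub>2\<rangle>\<rbrakk> \<Longrightarrow> M \<Colon> \<langle>\<Gamma> \<turnstile> Inter U\<^sub>1 U\<^sub>2\<rangle>"
| exp: "M \<Colon> \<langle>\<Gamma> \<turnstile> U\<rangle> \<Longrightarrow> lift j M \<Colon> \<langle>env_exp j \<Gamma> \<turnstile> Exp j U\<rangle>"
| sub: "\<lbrakk>M \<Colon> \<langle>\<Gamma> \<turnstile> U\<rangle>; sub_typing (\<Gamma>, U) (\<Gamma>', U')\<rbrakk> \<Longrightarrow> M \<Colon> \<langle>\<Gamma>' \<turnstile> U'\<rangle>"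

end

theory Submission
  imports Defs "HOL-Combinatorics.Transposition"
begin

text \<open>
  Assigning \<open>\<omega>\<^sup>L\<close> to every undeclared variable \<open>x\<^sup>L\<close> extends \<open>\<Gamma>\<close> to a total environment, whose
  restriction to the free variables of \<open>M\<close> is \<open>\<Gamma>\<up>\<^sup>M\<close>. Relative to total environments reduction is
  therefore undone without changing the environment, both parts of an application share one
  environment, and the two rules for abstractions merge, because \<open>\<omega>\<^sup>L\<close> is the greatest type of
  degree \<open>L\<close>.

  A single reduction step is undone by induction on the typing derivation of the reduct, not on the
  reduction; subtyping and intersection introduction are then trivial cases, and no generation
  lemmas are needed. For the expansion rule, a term of degree \<open>j::L\<close> and its reductions are lifted
  by \<open>j\<close> from a term of degree \<open>L\<close>. The redex itself only has to be treated at types in \<open>TT\<close>, where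
  the arrow rules apply: if \<open>M[x\<^sup>L := N]\<close> has type \<open>T\<close>, a second induction on typings collects the
  types at which the copies of \<open>N\<close> are used into one intersection \<open>V\<close>, so that \<open>N\<close> has type \<open>V\<close> and
  \<open>M\<close> has type \<open>T\<close> when \<open>x\<^sup>L\<close> is assigned \<open>V\<close>.
\<close>

section \<open>Terms\<close>

lemma joinable_mono: "\<lbrakk>joinable A B; A' \<subseteq> A; B' \<subseteq> B\<rbrakk> \<Longrightarrow> joinable A' B'"
  unfolding joinable_def by blast

lemma finite_fv [simp]: "finite (fv M)"
  by (induction M) auto

lemma terms_joinable_self: "M \<in> terms \<Longrightarrow> M \<diamondop> M"
proof (induction rule: terms.induct)
  case (app M N)
  then show ?case unfolding joinable_def by (simp, blast)
qed (auto simp: joinable_def fv_Abs)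

lemma terms_prefix_deg: "M \<in> terms \<Longrightarrow> (x, L) \<in> fv M \<Longrightarrow> prefix (deg M) L"
  by (induction rule: terms.induct) (auto simp: fv_Abs deg_Abs intro: prefix_order.trans)

lemma terms_AppD:
  assumes "App M N \<in> terms"
  shows "M \<in> terms" "N \<in> terms" "prefix (deg M) (deg N)" "M \<diamondop> N"
  using assms by (cases rule: terms.cases; simp add: Abs_def)+

lemma fv_subst: "fv (subst x L N M) = fv M - {(x, L)} \<union> (if (x, L) \<in> fv M then fv N else {})"
  by (induction M) auto

lemma subst_fresh: "(x, L) \<notin> fv M \<Longrightarrow> subst x L N M = M"
  by (induction M) auto

lemma deg_subst: "deg N = L \<Longrightarrow> deg (subst x L N M) = deg M"
  by (induction M) auto


subsection \<open>Opening binders\<close>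

primrec locally_closed :: "nat \<Rightarrow> 'v trm \<Rightarrow> bool" where
  "locally_closed k (Bnd n K) \<longleftrightarrow> n < k"
| "locally_closed k (Var x L) \<longleftrightarrow> True"
| "locally_closed k (App M N) \<longleftrightarrow> locally_closed k M \<and> locally_closed k N"
| "locally_closed k (Lam L M) \<longleftrightarrow> locally_closed (Suc k) M"

primrec open_var :: "nat \<Rightarrow> 'v \<Rightarrow> index \<Rightarrow> 'v trm \<Rightarrow> 'v trm" where
  "open_var k x L (Bnd n K) = (if n = k \<and> K = L then Var x L else Bnd n K)"
| "open_var k x L (Var y K) = Var y K"
| "open_var k x L (App M N) = App (open_var k x L M) (open_var k x L N)"
| "open_var k x L (Lam K M) = Lam K (open_var (Suc k) x L M)"

lemma locally_closed_mono: "locally_closed k M \<Longrightarrow> k \<le> k' \<Longrightarrow> locally_closed k' M"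
  by (induction M arbitrary: k k') auto

lemma locally_closed_close: "locally_closed k M \<Longrightarrow> locally_closed (Suc k) (close k x L M)"
  by (induction M arbitrary: k) auto

lemma terms_locally_closed: "M \<in> terms \<Longrightarrow> locally_closed 0 M"
  by (induction rule: terms.induct) (auto simp: Abs_def locally_closed_close)

lemma locally_closed_subst:
  "\<lbrakk>locally_closed k M; locally_closed 0 N\<rbrakk> \<Longrightarrow> locally_closed k (subst x L N M)"
  by (induction M arbitrary: k) (auto intro: locally_closed_mono)

lemma open_var_locally_closed: "locally_closed k M \<Longrightarrow> open_var k x L M = M"
  by (induction M arbitrary: k) auto

lemma close_open_var: "(x, L) \<notin> fv M \<Longrightarrow> close k x L (open_var k x L M) = M"
  by (induction M arbitrary: k) auto

lemma Abs_open_var: "(x, L) \<notin> fv M \<Longrightarrow> Abs x L (open_var 0 x L M) = Lam L M"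
  by (simp add: Abs_def close_open_var)

lemma open_var_close:
  "locally_closed k M \<Longrightarrow> open_var k y L (close k x L M) = subst x L (Var y L) M"
  by (induction M arbitrary: k) auto

lemma subst_open_var:
  assumes "(y, K) \<noteq> (x, L)" "locally_closed 0 N"
  shows "subst x L N (open_var k y K M) = open_var k y K (subst x L N M)"
  using assms
  by (induction M arbitrary: k) (auto simp: open_var_locally_closed locally_closed_mono)

lemma fv_open_var_subset: "fv (open_var k x L M) \<subseteq> insert (x, L) (fv M)"
  by (induction M arbitrary: k) auto

lemma joinable_open_var:
  assumes "M \<diamondop> N" "y \<notin> fst ` fv N"
  shows "open_var k y L M \<diamondop> N"
proof -
  have "(y, K) \<notin> fv N" for K using assms(2) by force
  then show ?thesis
    using assms(1) fv_open_var_subset[of k y L M] by (fastforce simp: joinable_def)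
qed

lemma deg_open_var [simp]: "deg (open_var k x L M) = deg M"
  by (induction M arbitrary: k) auto


subsection \<open>Renaming\<close>

lemma fv_map_trm: "fv (map_trm f M) = apfst f ` fv M"
  by (induction M) auto

lemma deg_map_trm [simp]: "deg (map_trm f M) = deg M"
  by (induction M) auto

lemma open_var_map_trm: "open_var k (f x) L (map_trm f M) = map_trm f (open_var k x L M)"
  by (induction M arbitrary: k) auto

lemma map_trm_Abs: "inj f \<Longrightarrow> map_trm f (Abs x L M) = Abs (f x) L (map_trm f M)"
proof -
  assume "inj f"
  then have "close k (f x) L (map_trm f M) = map_trm f (close k x L M)" for k
    by (induction M arbitrary: k) (auto simp: inj_eq)
  then show ?thesis by (simp add: Abs_def)
qed

lemma map_trm_subst:
  "inj f \<Longrightarrow> map_trm f (subst x L N M) = subst (f x) L (map_trm f N) (map_trm f M)"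
  by (induction M) (auto simp: inj_eq)

lemma map_trm_lift: "map_trm f (lift j M) = lift j (map_trm f M)"
  by (induction M) auto

lemma joinable_apfst:
  "inj f \<Longrightarrow> joinable (apfst f ` A) (apfst f ` B) \<longleftrightarrow> joinable A B"
  unfolding joinable_def by (fastforce simp: apfst_def inj_eq)

lemma terms_map_trm: "\<lbrakk>M \<in> terms; inj f\<rbrakk> \<Longrightarrow> map_trm f M \<in> terms"
  by (induction rule: terms.induct)
    (auto simp: map_trm_Abs fv_map_trm joinable_apfst intro!: terms.intros)

lemma beta_map_trm:
  assumes "M \<rhd>\<^sub>\<beta> N" "inj f"
  shows "map_trm f M \<rhd>\<^sub>\<beta> map_trm f N"
  using assms(1)
proof (induction rule: beta.induct)
  case (redex M N x L)
  then show ?case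
    using terms_map_trm[OF redex(3) assms(2)] assms(2)
    by (auto simp: map_trm_Abs map_trm_subst fv_map_trm joinable_apfst terms_map_trm
        intro!: beta.redex)
next
  case (abs M N x L)
  then show ?case
    using terms_map_trm[OF _ assms(2)] by (metis beta.abs map_trm_Abs assms(2))
qed (metis beta.appL beta.appR terms_map_trm assms(2) trm.map(3))+

text \<open>Renaming acts on a name at all its indexes simultaneously, as joinability demands. It agrees
  with the renaming of a single indexed variable, because a variable that is free in a term is
  free there with only one index.\<close>

lemma subst_Var_eq_map_trm_transpose:
  assumes "\<And>K. (x, K) \<in> fv M \<Longrightarrow> K = L" and "y \<noteq> x \<Longrightarrow> y \<notin> fst ` fv M"
  shows "subst x L (Var y L) M = map_trm (transpose x y) M"
  using assms by (induction M) (auto simp: transpose_def image_Un)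

lemma open_var_close_eq_map_trm_transpose:
  assumes "M \<in> terms" "(x, L) \<in> fv M" "y \<notin> fst ` fv (Abs x L M)" "locally_closed 0 N" "fv N \<subseteq> fv M"
  shows "open_var 0 y L (close 0 x L N) = map_trm (transpose x y) N"
proof -
  have index: "K = L" if "(x, K) \<in> fv M" for K
    using terms_joinable_self[OF assms(1)] assms(2) that unfolding joinable_def by blast
  have "y \<notin> fst ` fv M" if "y \<noteq> x" using assms(3) that by (force simp: fv_Abs)
  then show ?thesis
    using subst_Var_eq_map_trm_transpose[of x N L y] open_var_close[OF assms(4), of y L x] index
      assms(5) by (metis image_mono subsetD)
qed

lemma ex_renaming_open_var_close:
  assumes "M \<in> terms" "y \<notin> fst ` fv (Abs x L M)"
  shows "\<exists>f. inj f \<and> (\<forall>N. locally_closed 0 N \<longrightarrow> fv N \<subseteq> fv M \<longrightarrow>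
    open_var 0 y L (close 0 x L N) = map_trm f N)"
proof (cases "(x, L) \<in> fv M")
  case True
  then show ?thesis
    using open_var_close_eq_map_trm_transpose[OF assms(1) _ assms(2)] by (metis inj_transpose)
next
  case False
  have "open_var 0 y L (close 0 x L N) = map_trm id N" if "locally_closed 0 N" "fv N \<subseteq> fv M" for N
    using False that by (metis open_var_close subsetD subst_fresh trm.map_id)
  then show ?thesis by (intro exI[of _ id]) auto
qed

lemma terms_open_var:
  assumes "Lam L M \<in> terms" "y \<notin> fst ` fv M"
  shows "open_var 0 y L M \<in> terms"
proof -
  obtain x M\<^sub>0 where M: "M = close 0 x L M\<^sub>0" and M\<^sub>0: "M\<^sub>0 \<in> terms"
    using assms(1) by (cases rule: terms.cases) (auto simp: Abs_def)
  then obtain f where "inj f" "open_var 0 y L M = map_trm f M\<^sub>0"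
    using ex_renaming_open_var_close[of M\<^sub>0 y x L] assms(2) terms_locally_closed
    by (auto simp: Abs_def)
  then show ?thesis using terms_map_trm[OF M\<^sub>0] by simp
qed


subsection \<open>Reduction\<close>

lemma beta_terms: "M \<rhd>\<^sub>\<beta> N \<Longrightarrow> M \<in> terms"
  by (erule beta.cases) auto

lemma beta_locally_closed: "M \<rhd>\<^sub>\<beta> N \<Longrightarrow> locally_closed 0 N"
  by (erule beta.cases)
    (auto simp: terms_locally_closed locally_closed_subst dest: terms_AppD(1,2))

lemma beta_fv: "M \<rhd>\<^sub>\<beta> N \<Longrightarrow> fv N \<subseteq> fv M"
  by (induction rule: beta.induct) (auto simp: fv_Abs fv_subst)

lemma betas_fv: "M \<rhd>\<^sub>\<beta>\<^sup>* N \<Longrightarrow> fv N \<subseteq> fv M"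
  by (induction rule: rtranclp_induct) (auto dest: beta_fv)

lemma beta_deg: "M \<rhd>\<^sub>\<beta> N \<Longrightarrow> deg N = deg M"
  by (induction rule: beta.induct) (auto simp: deg_Abs deg_subst)

lemma beta_Lam_cases [consumes 1, case_names redex abs]:
  assumes "M \<rhd>\<^sub>\<beta> Lam L P"
  obtains (redex) x K M' N where "M = App (Abs x K M') N" "Lam L P = subst x K N M'"
      "M' \<in> terms" "N \<in> terms" "M \<in> terms" "deg N = K" "M' \<diamondop> N"
  | (abs) M' where "M = Lam L M'"
      "\<And>y. y \<notin> fst ` fv M' \<Longrightarrow> open_var 0 y L M' \<rhd>\<^sub>\<beta> open_var 0 y L P"
  using assms
proof (cases rule: beta.cases)
  case (redex M' N x K)
  then show thesis by (intro that(1)) auto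
next
  case (abs M\<^sub>0 P\<^sub>0 x K)
  then have M: "M = Lam L (close 0 x L M\<^sub>0)" and P: "P = close 0 x L P\<^sub>0" by (simp_all add: Abs_def)
  have "open_var 0 y L (close 0 x L M\<^sub>0) \<rhd>\<^sub>\<beta> open_var 0 y L P"
    if "y \<notin> fst ` fv (close 0 x L M\<^sub>0)" for y
  proof -
    have "y \<notin> fst ` fv (Abs x L M\<^sub>0)" using that by (simp add: Abs_def)
    then obtain f where "inj f" and f: "\<And>N. \<lbrakk>locally_closed 0 N; fv N \<subseteq> fv M\<^sub>0\<rbrakk> \<Longrightarrow>
        open_var 0 y L (close 0 x L N) = map_trm f N"
      using ex_renaming_open_var_close[OF beta_terms[OF abs(3)]] by blast
    moreover have "locally_closed 0 M\<^sub>0" "locally_closed 0 P\<^sub>0" "fv P\<^sub>0 \<subseteq> fv M\<^sub>0"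
      using abs(3) beta_terms terms_locally_closed beta_locally_closed beta_fv by blast+
    ultimately have "open_var 0 y L (close 0 x L M\<^sub>0) = map_trm f M\<^sub>0"
      "open_var 0 y L P = map_trm f P\<^sub>0"
      unfolding P by simp_all
    then show ?thesis using beta_map_trm[OF abs(3) \<open>inj f\<close>] by simp
  qed
  then show thesis using that(2) M by blast
qed


subsection \<open>Lifting\<close>

lemma fv_lift: "fv (lift j M) = apsnd ((#) j) ` fv M"
  by (induction M) auto

lemma deg_lift [simp]: "deg (lift j M) = j # deg M"
  by (induction M) auto

lemma lift_inject [simp]: "lift j M = lift j N \<longleftrightarrow> M = N"
proof (induction M arbitrary: N)
  case (Bnd n K)
  show ?case by (cases N) auto
next
  case (Var x K)
  show ?case by (cases N) auto
next
  case (App M\<^sub>1 M\<^sub>2)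
  then show ?case by (cases N) auto
next
  case (Lam K M)
  then show ?case by (cases N) auto
qed

lemma subst_lift: "subst x (j # L) (lift j N) (lift j M) = lift j (subst x L N M)"
  by (induction M) auto

lemma joinable_lift:
  "joinable (apsnd ((#) j) ` A) (apsnd ((#) j) ` B) \<longleftrightarrow> joinable A B"
  unfolding joinable_def by force

lemma App_eq_lift_iff:
  "App M N = lift j P \<longleftrightarrow> (\<exists>M' N'. P = App M' N' \<and> M = lift j M' \<and> N = lift j N')"
  by (cases P) auto

lemma close_eq_lift:
  "close k x (j # L) M = lift j P \<Longrightarrow> \<exists>M'. P = close k x L M' \<and> M = lift j M'"
proof (induction M arbitrary: k P)
  case (Bnd n K)
  then show ?case by (cases P) (auto intro!: exI[of _ P])
next
  case (Var y K)
  show ?case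
  proof (cases "y = x \<and> K = j # L")
    case True
    then show ?thesis using Var by (cases P) (auto intro!: exI[of _ "Var x L"])
  next
    case False
    then show ?thesis using Var by (cases P) (auto intro!: exI[of _ P])
  qed
next
  case (App M N)
  then show ?case by (cases P) (auto, metis close.simps(3) lift.simps(3))
next
  case (Lam K M)
  then show ?case by (cases P) (auto, metis close.simps(4) lift.simps(4))
qed

lemma Abs_eq_lift_iff:
  "Abs x K M = lift j P \<longleftrightarrow> (\<exists>L M'. P = Abs x L M' \<and> K = j # L \<and> M = lift j M')"
proof
  assume eq: "Abs x K M = lift j P"
  then obtain L P' where P: "P = Lam L P'" by (cases P) (auto simp: Abs_def)
  then have "K = j # L" "lift j P' = close 0 x (j # L) M" using eq by (auto simp: Abs_def)
  then show "\<exists>L M'. P = Abs x L M' \<and> K = j # L \<and> M = lift j M'"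
    using close_eq_lift P by (metis Abs_def)
qed (auto simp: lift_Abs)

lemma terms_lift_iff [simp]: "lift j M \<in> terms \<longleftrightarrow> M \<in> terms"
proof
  assume "lift j M \<in> terms"
  then show "M \<in> terms"
  proof (induction "lift j M" arbitrary: M rule: terms.induct)
    case (var x L)
    then show ?case by (cases M) (auto intro: terms.var)
  qed (auto simp: App_eq_lift_iff Abs_eq_lift_iff fv_lift joinable_lift intro!: terms.intros)
next
  assume "M \<in> terms"
  then show "lift j M \<in> terms"
    by (induction rule: terms.induct)
      (auto simp: lift_Abs fv_lift joinable_lift intro!: terms.intros)
qed

lemma terms_deg_Cons: "M \<in> terms \<Longrightarrow> deg M = j # K \<Longrightarrow> M \<in> range (lift j)"
proof (induction arbitrary: K rule: terms.induct)
  case (var x L)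
  then show ?case by (auto intro: range_eqI[of _ _ "Var x K"])
next
  case (app M N)
  then show ?case by (auto simp: prefix_def simp flip: lift.simps(3))
next
  case (abs M L x)
  then show ?case by (auto simp: prefix_def deg_Abs simp flip: lift_Abs)
qed

lemma beta_liftD: "lift j M \<rhd>\<^sub>\<beta> lift j P \<Longrightarrow> M \<rhd>\<^sub>\<beta> P"
proof (induction "lift j M" "lift j P" arbitrary: M P rule: beta.induct)
  case (redex Q N x L)
  then obtain Q' L' N' where M: "M = App (Abs x L' Q') N'"
    and lift: "Q = lift j Q'" "L = j # L'" "N = lift j N'"
    by (auto simp: App_eq_lift_iff Abs_eq_lift_iff)
  then have "P = subst x L' N' Q'" using redex by (simp add: subst_lift)
  moreover have "M \<in> terms" using redex by (metis terms_lift_iff)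
  ultimately show ?case
    using redex lift by (auto simp: M fv_lift joinable_lift intro!: beta.redex)
next
  case (abs Q N x L)
  then show ?case by (auto simp: Abs_eq_lift_iff intro!: beta.abs)
qed (auto simp: App_eq_lift_iff intro!: beta.intros)


section \<open>Types and environments\<close>

lemma Inter_idem [simp]: "Inter U U = U"
  by transfer (rule teq.idem)

lemma Inter_commute: "tdeg U = tdeg V \<Longrightarrow> Inter U V = Inter V U"
  by transfer (rule teq.comm)

lemma Inter_Omega: "Inter (Omega (tdeg U)) U = U"
  by transfer (simp add: teq.omega_inter)

lemma Exp_Omega: "Exp i (Omega K) = Omega (i # K)"
  by transfer (rule teq.exp_omega)

lemma tdeg_simps [simp]:
  "tdeg (Atom a) = []" "tdeg (Arrow U T) = []" "tdeg (Omega L) = L"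
  "tdeg (Inter U V) = tdeg U" "tdeg (Exp i U) = i # tdeg U"
  by (transfer, simp)+

lemma tdeg_TT: "T \<in> TT \<Longrightarrow> tdeg T = []"
  by (erule TT.cases) auto

lemma sub_imp_UU: "U \<sqsubseteq> V \<Longrightarrow> U \<in> UU \<and> V \<in> UU"
  and sub_imp_tdeg_eq: "U \<sqsubseteq> V \<Longrightarrow> tdeg U = tdeg V"
  by (induction rule: sub.induct) (auto intro: TT_UU.intros)

lemma sub_inter_elim_right: "\<lbrakk>U \<in> UU; V \<in> UU; tdeg U = tdeg V\<rbrakk> \<Longrightarrow> Inter U V \<sqsubseteq> V"
  using sub.inter_elim[of V U] Inter_commute[of U V] by simp

lemma sub_Omega: "U \<in> UU \<Longrightarrow> U \<sqsubseteq> Omega (tdeg U)"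
  using sub.inter_elim[OF TT_UU.omega, of U "tdeg U"] by (simp add: Inter_Omega)

lemma wf_envD: "\<lbrakk>wf_env \<Gamma>; \<Gamma> v = Some U\<rbrakk> \<Longrightarrow> U \<in> UU"
  by (auto simp: wf_env_def dest: ranI)

lemma wf_env_rel_option_refl: "wf_env \<Gamma> \<Longrightarrow> rel_option (\<sqsubseteq>) (\<Gamma> v) (\<Gamma> v)"
  by (cases "\<Gamma> v") (auto intro: sub.refl wf_envD)

lemma sub_env_rel_option: "sub_env \<Gamma> \<Delta> \<Longrightarrow> rel_option (\<sqsubseteq>) (\<Gamma> v) (\<Delta> v)"
proof (induction rule: sub_env.induct)
  case (trans \<Gamma>\<^sub>1 \<Gamma>\<^sub>2 \<Gamma>\<^sub>3)
  then show ?case by (auto elim!: option.rel_cases intro: sub.trans)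
qed (auto simp: wf_env_rel_option_refl)

lemma sub_typingD: "sub_typing \<Phi> \<Psi> \<Longrightarrow> snd \<Phi> \<sqsubseteq> snd \<Psi> \<and> sub_env (fst \<Psi>) (fst \<Phi>)"
  by (induction rule: sub_typing.induct) (auto intro: sub.intros sub_env.intros)

lemma sub_typing_rel_option:
  "sub_typing (\<Gamma>, U) (\<Gamma>', U') \<Longrightarrow> rel_option (\<sqsubseteq>) (\<Gamma>' v) (\<Gamma> v)"
  using sub_typingD[of "(\<Gamma>, U)" "(\<Gamma>', U')"] by (simp add: sub_env_rel_option)

lemma dom_env_omega: "dom (env_omega M) = fv M"
  by (auto simp: env_omega_def split: if_splits)

lemma env_omega_Var: "env_omega (Var x L) = [(x, L) \<mapsto> Omega L]"
  by (auto simp: env_omega_def)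

lemma dom_env_inter: "dom (env_inter \<Gamma> \<Delta>) = dom \<Gamma> \<union> dom \<Delta>"
  by (auto simp: env_inter_def domIff split: option.splits)

lemma env_exp_eq_Some_iff:
  "env_exp j \<Gamma> (x, K) = Some V \<longleftrightarrow> (\<exists>L U. K = j # L \<and> \<Gamma> (x, L) = Some U \<and> V = Exp j U)"
  by (cases K) (auto simp: env_exp_def)

lemma dom_env_exp: "dom (env_exp j \<Gamma>) = apsnd ((#) j) ` dom \<Gamma>"
  by (force simp: dom_def env_exp_eq_Some_iff)

lemma typing_dom: "M \<Colon> \<langle>\<Gamma> \<turnstile> U\<rangle> \<Longrightarrow> dom \<Gamma> = fv M"
proof (induction rule: typing.induct)
  case (arrI M \<Gamma> x L U T)
  then have "insert (x, L) (dom \<Gamma>) = fv M" by (simp del: fun_upd_apply)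
  then show ?case using arrI.hyps(2) by (metis Diff_insert_absorb fv_Abs)
next
  case (sub M \<Gamma> U \<Gamma>' U')
  have "\<Gamma>' v = None \<longleftrightarrow> \<Gamma> v = None" for v
    using sub_typing_rel_option[OF sub.hyps(2), of v]
    by (auto simp: option_rel_Some1 option_rel_Some2)
  then show ?case using sub.IH by (simp add: dom_def)
qed (auto simp: fv_Abs dom_env_omega dom_env_inter dom_env_exp fv_lift split: if_splits)

lemma typing_env_SomeD:
  "\<lbrakk>M \<Colon> \<langle>\<Gamma> \<turnstile> U\<rangle>; \<Gamma> (x, L) = Some V\<rbrakk> \<Longrightarrow> V \<in> UU \<and> tdeg V = L"
proof (induction arbitrary: x L V rule: typing.induct)
  case (arrI M \<Gamma> y K U T)
  then show ?case by (metis domI fun_upd_other)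
next
  case (sub M \<Gamma> U \<Gamma>' U')
  obtain W where "\<Gamma> (x, L) = Some W" "V \<sqsubseteq> W"
    using sub_typing_rel_option[OF sub.hyps(2), of "(x, L)"] sub.prems
    by (auto simp: option_rel_Some1)
  then show ?case using sub.IH[of x L W] sub_imp_UU sub_imp_tdeg_eq by metis
qed (auto simp: env_omega_def env_inter_def env_exp_eq_Some_iff tdeg_TT intro: TT_UU.intros
    split: if_splits option.splits)


subsection \<open>Total environments\<close>

type_synonym ('v, 'a) tenv = "'v ivar \<Rightarrow> 'a ty"

definition wf_tenv :: "('v, 'a) tenv \<Rightarrow> bool" where
  "wf_tenv E \<longleftrightarrow> (\<forall>x L. E (x, L) \<in> UU \<and> tdeg (E (x, L)) = L)"

definition total_env :: "('v, 'a) env \<Rightarrow> ('v, 'a) tenv" where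
  "total_env \<Gamma> = (\<lambda>(x, L). case \<Gamma> (x, L) of None \<Rightarrow> Omega L | Some U \<Rightarrow> U)"

definition env_on :: "('v, 'a) tenv \<Rightarrow> 'v ivar set \<Rightarrow> ('v, 'a) env" where
  "env_on E A = (Some \<circ> E) |` A"

definition tenv_exp :: "nat \<Rightarrow> ('v, 'a) tenv \<Rightarrow> ('v, 'a) tenv" where
  "tenv_exp j E = (\<lambda>(x, K). case K of
      [] \<Rightarrow> Omega []
    | i # L \<Rightarrow> if i = j then Exp j (E (x, L)) else Omega K)"

definition tenv_le :: "('v, 'a) tenv \<Rightarrow> ('v, 'a) env \<Rightarrow> bool" where
  "tenv_le E \<Gamma> \<longleftrightarrow> (\<forall>v V. \<Gamma> v = Some V \<longrightarrow> E v \<sqsubseteq> V)"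

lemma wf_tenvD: "wf_tenv E \<Longrightarrow> E v \<in> UU" "wf_tenv E \<Longrightarrow> tdeg (E (x, L)) = L"
  by (cases v) (auto simp: wf_tenv_def)

lemma wf_tenv_sub_refl: "wf_tenv E \<Longrightarrow> E v \<sqsubseteq> E v"
  by (simp add: sub.refl wf_tenvD)

lemma wf_tenv_fun_upd: "\<lbrakk>wf_tenv E; U \<in> UU; tdeg U = L\<rbrakk> \<Longrightarrow> wf_tenv (E((x, L) := U))"
  by (auto simp: wf_tenv_def)

lemma wf_tenv_fun_updD:
  assumes "wf_tenv (E((x, L) := U))"
  shows "U \<in> UU" "tdeg U = L"
  using wf_tenvD[OF assms] by (metis fun_upd_same)+

lemma wf_tenv_tenv_exp: "wf_tenv E \<Longrightarrow> wf_tenv (tenv_exp j E)"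
  by (auto simp: wf_tenv_def tenv_exp_def intro: TT_UU.intros split: list.splits)

lemma tenv_exp_fun_upd: "tenv_exp j (E((x, L) := U)) = (tenv_exp j E)((x, j # L) := Exp j U)"
  by (auto simp: tenv_exp_def fun_eq_iff split: list.splits)

lemma env_on_apply: "env_on E A v = (if v \<in> A then Some (E v) else None)"
  by (simp add: env_on_def restrict_map_def)

lemma env_on_fun_upd: "v \<in> A \<Longrightarrow> env_on (E(v := U)) A = (env_on E (A - {v}))(v \<mapsto> U)"
  by (auto simp: env_on_apply)

lemma dom_env_on [simp]: "dom (env_on E A) = A"
  by (auto simp: env_on_apply split: if_splits)

lemma env_inter_env_on: "env_inter (env_on E A) (env_on E B) = env_on E (A \<union> B)"
  by (auto simp: env_inter_def env_on_apply split: option.splits)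

lemma env_exp_env_on: "env_exp j (env_on E A) = env_on (tenv_exp j E) (apsnd ((#) j) ` A)"
proof -
  have "(x, K) \<in> apsnd ((#) j) ` A \<longleftrightarrow> (\<exists>L. K = j # L \<and> (x, L) \<in> A)" for x K
    by force
  then show ?thesis
    by (auto simp: env_exp_def tenv_exp_def env_on_apply fun_eq_iff split: list.splits)
qed

lemma env_on_total_env: "dom \<Gamma> \<subseteq> fv M \<Longrightarrow> env_on (total_env \<Gamma>) (fv M) = env_up \<Gamma> M"
  by (auto simp: env_on_apply total_env_def env_up_def env_omega_def map_add_def fun_eq_iff
      split: option.splits)

lemma env_omega_eq_env_on: "env_omega M = env_on (\<lambda>(x, L). Omega L) (fv M)"
  by (auto simp: env_omega_def env_on_apply)

lemma tenv_exp_total_env: "tenv_exp j (total_env \<Gamma>) = total_env (env_exp j \<Gamma>)"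
  by (auto simp: tenv_exp_def total_env_def env_exp_def Exp_Omega fun_eq_iff
      split: list.splits option.splits)

lemma tenv_leI: "(\<And>v V. \<Gamma> v = Some V \<Longrightarrow> E v \<sqsubseteq> V) \<Longrightarrow> tenv_le E \<Gamma>"
  and tenv_leD: "\<lbrakk>tenv_le E \<Gamma>; \<Gamma> v = Some V\<rbrakk> \<Longrightarrow> E v \<sqsubseteq> V"
  unfolding tenv_le_def by blast+

lemma tenv_le_env_on: "(\<And>v. v \<in> A \<Longrightarrow> E' v \<sqsubseteq> E v) \<Longrightarrow> tenv_le E' (env_on E A)"
  by (rule tenv_leI) (auto simp: env_on_apply split: if_splits)

lemma tenv_le_cong: "\<lbrakk>tenv_le E \<Gamma>; \<And>v. v \<in> dom \<Gamma> \<Longrightarrow> E' v = E v\<rbrakk> \<Longrightarrow> tenv_le E' \<Gamma>"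
  by (metis domI tenv_leD tenv_leI)

lemma tenv_le_fun_upd: "\<lbrakk>tenv_le E \<Gamma>; U \<in> UU\<rbrakk> \<Longrightarrow> tenv_le (E(v := U)) (\<Gamma>(v \<mapsto> U))"
  by (rule tenv_leI) (auto intro: sub.refl tenv_leD split: if_splits)

lemma tenv_le_imp_sub_total_env: "\<lbrakk>wf_tenv E; tenv_le E \<Gamma>\<rbrakk> \<Longrightarrow> E v \<sqsubseteq> total_env \<Gamma> v"
  using sub_Omega[of "E v"]
  by (cases v) (auto simp: total_env_def wf_tenvD tenv_leD split: option.splits)

lemma tenv_le_total_env: "M \<Colon> \<langle>\<Gamma> \<turnstile> U\<rangle> \<Longrightarrow> tenv_le (total_env \<Gamma>) \<Gamma>"
  by (auto simp: tenv_le_def total_env_def intro!: sub.refl dest: typing_env_SomeD)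

lemma wf_tenv_total_env: "M \<Colon> \<langle>\<Gamma> \<turnstile> U\<rangle> \<Longrightarrow> wf_tenv (total_env \<Gamma>)"
  by (auto simp: wf_tenv_def total_env_def intro: TT_UU.omega dest: typing_env_SomeD
      split: option.splits)

lemma tenv_le_sub_typing:
  assumes "tenv_le E \<Gamma>'" "sub_typing (\<Gamma>, U) (\<Gamma>', U')"
  shows "tenv_le E \<Gamma>"
proof (rule tenv_leI)
  fix v V assume "\<Gamma> v = Some V"
  then obtain W where "\<Gamma>' v = Some W" "W \<sqsubseteq> V"
    using sub_typing_rel_option[OF assms(2), of v] by (auto simp: option_rel_Some2)
  then show "E v \<sqsubseteq> V" using tenv_leD[OF assms(1)] sub.trans by blast
qed

lemma env_inter_commute:
  assumes "M\<^sub>1 \<Colon> \<langle>\<Gamma>\<^sub>1 \<turnstile> U\<^sub>1\<rangle>" "M\<^sub>2 \<Colon> \<langle>\<Gamma>\<^sub>2 \<turnstile> U\<^sub>2\<rangle>"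
  shows "env_inter \<Gamma>\<^sub>1 \<Gamma>\<^sub>2 = env_inter \<Gamma>\<^sub>2 \<Gamma>\<^sub>1"
  using typing_env_SomeD[OF assms(1)] typing_env_SomeD[OF assms(2)]
  by (auto simp: env_inter_def fun_eq_iff split: option.splits intro!: Inter_commute)

lemma tenv_le_env_inter_left:
  assumes "tenv_le E (env_inter \<Gamma>\<^sub>1 \<Gamma>\<^sub>2)" "M\<^sub>1 \<Colon> \<langle>\<Gamma>\<^sub>1 \<turnstile> U\<^sub>1\<rangle>" "M\<^sub>2 \<Colon> \<langle>\<Gamma>\<^sub>2 \<turnstile> U\<^sub>2\<rangle>"
  shows "tenv_le E \<Gamma>\<^sub>1"
proof (rule tenv_leI)
  fix v V assume V: "\<Gamma>\<^sub>1 v = Some V"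
  show "E v \<sqsubseteq> V"
  proof (cases "\<Gamma>\<^sub>2 v")
    case None
    then have "env_inter \<Gamma>\<^sub>1 \<Gamma>\<^sub>2 v = Some V" using V by (simp add: env_inter_def)
    then show ?thesis using tenv_leD[OF assms(1)] by blast
  next
    case (Some W)
    then have "env_inter \<Gamma>\<^sub>1 \<Gamma>\<^sub>2 v = Some (Inter V W)" using V by (simp add: env_inter_def)
    then have "E v \<sqsubseteq> Inter V W" using tenv_leD[OF assms(1)] by blast
    moreover have "Inter V W \<sqsubseteq> V"
      using V Some typing_env_SomeD[OF assms(2)] typing_env_SomeD[OF assms(3)]
      by (cases v) (auto intro!: sub.inter_elim)
    ultimately show ?thesis by (rule sub.trans)
  qed
qed

lemma tenv_le_env_inter:
  assumes "tenv_le E (env_inter \<Gamma>\<^sub>1 \<Gamma>\<^sub>2)" "M\<^sub>1 \<Colon> \<langle>\<Gamma>\<^sub>1 \<turnstile> U\<^sub>1\<rangle>" "M\<^sub>2 \<Colon> \<langle>\<Gamma>\<^sub>2 \<turnstile> U\<^sub>2\<rangle>"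
  shows "tenv_le E \<Gamma>\<^sub>1" "tenv_le E \<Gamma>\<^sub>2"
  using assms tenv_le_env_inter_left env_inter_commute by metis+

lemma sub_env_env_on:
  assumes "finite A" "\<And>v. v \<in> A \<Longrightarrow> E v \<sqsubseteq> E' v"
  shows "sub_env (env_on E A) (env_on E' A)"
proof -
  have wf: "wf_env (env_on (override_on E E' S) B)" if "B \<subseteq> A" for S B
  proof -
    have "override_on E E' S v \<in> UU" if "v \<in> B" for v
      using sub_imp_UU[OF assms(2), of v] that \<open>B \<subseteq> A\<close> by (auto simp: override_on_def)
    then have "ran (env_on (override_on E E' S) B) \<subseteq> UU"
      by (auto simp: ran_def env_on_apply split: if_splits)
    then show ?thesis using finite_subset[OF that assms(1)] by (simp add: wf_env_def)
  qed
  have "sub_env (env_on E A) (env_on (override_on E E' S) A)" if "finite S" "S \<subseteq> A" for S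
    using that
  proof (induction S rule: finite_induct)
    case empty
    then show ?case using wf[of A "{}"] by (simp add: sub_env.refl)
  next
    case (insert v S)
    let ?F = "override_on E E' S"
    obtain y L where v: "v = (y, L)" by (cases v)
    have "sub_env ((env_on ?F (A - {v}))(v \<mapsto> E v)) ((env_on ?F (A - {v}))(v \<mapsto> E' v))"
      unfolding v using insert.prems assms(2) v by (intro sub_env.decl wf) auto
    moreover have "(env_on ?F (A - {v}))(v \<mapsto> E v) = env_on ?F A"
      using insert.hyps insert.prems by (auto simp: env_on_apply override_on_def)
    moreover have "(env_on ?F (A - {v}))(v \<mapsto> E' v) = env_on (override_on E E' (insert v S)) A"
      using insert.prems by (simp add: override_on_insert env_on_fun_upd)
    ultimately show ?case using insert by (auto intro: sub_env.trans)
  qed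
  from this[OF assms(1) order_refl] show ?thesis
    by (metis (no_types, lifting) env_on_apply ext override_on_apply_in)
qed


section \<open>Typing in total environments\<close>

text \<open>The premise of the rule for abstractions is required for all but finitely many names of the
  bound variable, so that inductions may choose this name fresh.\<close>

inductive ttyping :: "('v, 'a) tenv \<Rightarrow> 'v trm \<Rightarrow> 'a ty \<Rightarrow> bool" ("(_ \<tturnstile> _ \<Colon> _)" [51, 51, 51] 50)
where
  var: "\<lbrakk>wf_tenv E; E (x, []) \<in> TT\<rbrakk> \<Longrightarrow> E \<tturnstile> Var x [] \<Colon> E (x, [])"
| omega: "\<lbrakk>wf_tenv E; M \<in> terms\<rbrakk> \<Longrightarrow> E \<tturnstile> M \<Colon> Omega (deg M)"
| lam: "\<lbrakk>wf_tenv E; U \<in> UU; tdeg U = L; T \<in> TT; finite C;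
      \<And>y. y \<notin> C \<Longrightarrow> E((y, L) := U) \<tturnstile> open_var 0 y L M \<Colon> T\<rbrakk> \<Longrightarrow> E \<tturnstile> Lam L M \<Colon> Arrow U T"
| app: "\<lbrakk>E \<tturnstile> M \<Colon> Arrow U T; E \<tturnstile> N \<Colon> U; M \<diamondop> N; T \<in> TT\<rbrakk> \<Longrightarrow> E \<tturnstile> App M N \<Colon> T"
| inter: "\<lbrakk>E \<tturnstile> M \<Colon> U\<^sub>1; E \<tturnstile> M \<Colon> U\<^sub>2\<rbrakk> \<Longrightarrow> E \<tturnstile> M \<Colon> Inter U\<^sub>1 U\<^sub>2"
| exp: "E \<tturnstile> M \<Colon> U \<Longrightarrow> tenv_exp j E \<tturnstile> lift j M \<Colon> Exp j U"
| sub: "\<lbrakk>E \<tturnstile> M \<Colon> U; \<And>v. E' v \<sqsubseteq> E v; U \<sqsubseteq> U'\<rbrakk> \<Longrightarrow> E' \<tturnstile> M \<Colon> U'"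

lemma ttyping_wf_tenv: "E \<tturnstile> M \<Colon> U \<Longrightarrow> wf_tenv E"
proof (induction rule: ttyping.induct)
  case (sub E M U E' U')
  then show ?case by (metis sub_imp_UU sub_imp_tdeg_eq wf_tenv_def)
qed (auto simp: wf_tenv_tenv_exp)

lemma ttyping_UU: "E \<tturnstile> M \<Colon> U \<Longrightarrow> U \<in> UU"
  and ttyping_tdeg: "E \<tturnstile> M \<Colon> U \<Longrightarrow> tdeg U = deg M"
  and ttyping_terms: "E \<tturnstile> M \<Colon> U \<Longrightarrow> M \<in> terms"
  for E :: "('v::infinite, 'a) tenv"
proof (induction rule: ttyping.induct)
  case (lam E U L T C M)
  obtain y where y: "y \<notin> C \<union> fst ` fv M" using arb_element[of "C \<union> fst ` fv M"] lam.hyps(5) by auto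
  have deg: "deg M = []" using lam.IH(2)[of y] y lam.hyps(4) by (simp add: tdeg_TT)
  have "open_var 0 y L M \<in> terms" using lam.IH(3)[of y] y by blast
  then have "Abs y L (open_var 0 y L M) \<in> terms" by (rule terms.abs) (simp add: deg)
  moreover have "(y, L) \<notin> fv M" using y by force
  ultimately have terms: "Lam L M \<in> terms" by (simp add: Abs_open_var)
  {
    case 1 show ?case using lam.hyps by (blast intro: TT_UU.TT_UU TT_UU.arrow)
  next
    case 2 show ?case by (simp add: deg)
  next
    case 3 show ?case by (fact terms)
  }
qed (auto simp: wf_tenvD tdeg_TT dest: sub_imp_UU sub_imp_tdeg_eq intro: terms.intros TT_UU.intros)


subsection \<open>Renaming\<close>

definition tenv_map :: "('v \<Rightarrow> 'w) \<Rightarrow> ('v, 'a) tenv \<Rightarrow> ('w, 'a) tenv" where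
  "tenv_map f E = (\<lambda>(x, L). E (inv f x, L))"

lemma tenv_map_apply [simp]: "tenv_map f E (x, L) = E (inv f x, L)"
  by (simp add: tenv_map_def)

lemma wf_tenv_tenv_map: "wf_tenv E \<Longrightarrow> wf_tenv (tenv_map f E)"
  by (simp add: wf_tenv_def)

lemma tenv_map_fun_upd:
  "bij f \<Longrightarrow> tenv_map f (E((x, L) := U)) = (tenv_map f E)((f x, L) := U)"
  by (auto simp: fun_eq_iff bij_is_inj bij_is_surj surj_f_inv_f)

lemma tenv_map_tenv_exp: "tenv_map f (tenv_exp j E) = tenv_exp j (tenv_map f E)"
  by (auto simp: tenv_exp_def fun_eq_iff split: list.splits)

lemma ttyping_map_trm:
  assumes "E \<tturnstile> M \<Colon> U" "bij f"
  shows "tenv_map f E \<tturnstile> map_trm f M \<Colon> U"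
  using assms(1)
proof (induction rule: ttyping.induct)
  case (var E x)
  then show ?case
    using ttyping.var[of "tenv_map f E" "f x"] assms(2) by (simp add: bij_is_inj wf_tenv_tenv_map)
next
  case (omega E M)
  then show ?case
    using ttyping.omega[of "tenv_map f E" "map_trm f M"] assms(2)
    by (simp add: terms_map_trm bij_is_inj wf_tenv_tenv_map)
next
  case (lam E U L T C M)
  have "(tenv_map f E)((y, L) := U) \<tturnstile> open_var 0 y L (map_trm f M) \<Colon> T" if "y \<notin> f ` C" for y
  proof -
    have y: "f (inv f y) = y" using assms(2) by (simp add: bij_is_surj surj_f_inv_f)
    then have "inv f y \<notin> C" using that by (metis imageI)
    then have "tenv_map f (E((inv f y, L) := U)) \<tturnstile> map_trm f (open_var 0 (inv f y) L M) \<Colon> T"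
      by (rule lam.IH)
    then show ?thesis by (simp add: tenv_map_fun_upd[OF assms(2)] y flip: open_var_map_trm)
  qed
  then show ?case
    using lam.hyps by (auto simp: wf_tenv_tenv_map intro!: ttyping.lam[of _ _ _ _ "f ` C"])
next
  case (app E M U T N)
  then show ?case
    using assms(2) by (auto simp: fv_map_trm joinable_apfst bij_is_inj intro: ttyping.app)
next
  case (exp E M U j)
  then show ?case by (auto simp: map_trm_lift tenv_map_tenv_exp intro: ttyping.exp)
next
  case (sub E M U E' U')
  have "tenv_map f E' v \<sqsubseteq> tenv_map f E v" for v by (cases v) (simp add: sub.hyps(2))
  with sub.IH show ?case using sub.hyps(3) by (rule ttyping.sub)
qed (auto intro: ttyping.inter)

lemma tenv_map_transpose_fun_upd_eq:
  assumes "M \<in> terms" "(x, L) \<in> fv M" "y \<notin> fst ` fv (Abs x L M)" "v \<in> fv M"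
  shows "tenv_map (transpose x y) (E((y, L) := U)) v = (E((x, L) := U)) v"
proof -
  obtain z K where v: "v = (z, K)" by (cases v)
  have "z = x \<Longrightarrow> K = L"
    using terms_joinable_self[OF assms(1)] assms(2,4) v by (auto simp: joinable_def)
  moreover have "z = y \<Longrightarrow> z = x" using assms(3,4) v by (force simp: fv_Abs)
  ultimately show ?thesis by (auto simp: v transpose_def)
qed

lemma ttyping_AbsI:
  fixes E :: "('v::infinite, 'a) tenv"
  assumes E: "wf_tenv E" "tenv_le (E((x, L) := U)) \<Gamma>" and U: "U \<in> UU" "tdeg U = L" and "T \<in> TT"
    and \<Gamma>: "dom \<Gamma> = fv M" and M: "\<And>E'. \<lbrakk>wf_tenv E'; tenv_le E' \<Gamma>\<rbrakk> \<Longrightarrow> E' \<tturnstile> M \<Colon> T"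
  shows "E \<tturnstile> Abs x L M \<Colon> Arrow U T"
  unfolding Abs_def
proof (rule ttyping.lam[OF E(1) U \<open>T \<in> TT\<close>])
  have wf: "wf_tenv (E((z, L) := U))" for z using E(1) U by (rule wf_tenv_fun_upd)
  then have terms: "M \<in> terms" using M E(2) ttyping_terms by blast
  show "finite (fst ` fv (Abs x L M))" by simp
  fix y assume y: "y \<notin> fst ` fv (Abs x L M)"
  let ?E = "E((y, L) := U)" and ?f = "transpose x y"
  show "?E \<tturnstile> open_var 0 y L (close 0 x L M) \<Colon> T"
  proof (cases "(x, L) \<in> fv M")
    case True
    have "tenv_le (tenv_map ?f ?E) \<Gamma>"
      using E(2) tenv_map_transpose_fun_upd_eq[OF terms True y] by (rule tenv_le_cong) (simp add: \<Gamma>)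
    then have "tenv_map ?f (tenv_map ?f ?E) \<tturnstile> map_trm ?f M \<Colon> T"
      using wf by (intro ttyping_map_trm M wf_tenv_tenv_map) auto
    moreover have "tenv_map ?f (tenv_map ?f ?E) = ?E" by (auto simp: fun_eq_iff)
    ultimately show ?thesis
      using open_var_close_eq_map_trm_transpose[OF terms True y terms_locally_closed[OF terms]]
      by simp
  next
    case False
    have "(y, L) \<notin> fv M" using y False by (force simp: fv_Abs)
    with False have "?E v = (E((x, L) := U)) v" if "v \<in> fv M" for v using that by auto
    with E(2) have "tenv_le ?E \<Gamma>" by (rule tenv_le_cong) (simp add: \<Gamma>)
    with wf have "?E \<tturnstile> M \<Colon> T" by (rule M)
    then show ?thesis
      using False terms_locally_closed[OF terms] by (simp add: close_fresh open_var_locally_closed)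
  qed
qed


subsection \<open>Equivalence with typing in finite environments\<close>

lemma typing_sub_env_on:
  assumes "M \<Colon> \<langle>env_on E (fv M) \<turnstile> U\<rangle>" "\<And>v. v \<in> fv M \<Longrightarrow> E' v \<sqsubseteq> E v" "U \<sqsubseteq> U'"
  shows "M \<Colon> \<langle>env_on E' (fv M) \<turnstile> U'\<rangle>"
  using assms(1) sub_typing.pair[OF assms(3) sub_env_env_on[OF finite_fv assms(2)]]
  by (rule typing.sub)

lemma typing_omega_env_on:
  assumes "wf_tenv E" "M \<in> terms"
  shows "M \<Colon> \<langle>env_on E (fv M) \<turnstile> Omega (deg M)\<rangle>"
proof -
  have "M \<Colon> \<langle>env_on (\<lambda>(x, L). Omega L) (fv M) \<turnstile> Omega (deg M)\<rangle>"
    using typing.omega[OF assms(2)] by (simp flip: env_omega_eq_env_on)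
  moreover have "E v \<sqsubseteq> (case v of (x, L) \<Rightarrow> Omega L)" for v
    using sub_Omega[of "E v"] wf_tenvD[OF assms(1)] by (cases v) simp
  ultimately show ?thesis by (rule typing_sub_env_on) (auto intro: sub.refl TT_UU.omega)
qed

lemma typing_Abs_env_on:
  assumes M: "M \<Colon> \<langle>env_on (E((x, L) := U)) (fv M) \<turnstile> T\<rangle>" and T: "T \<in> TT"
    and U: "U \<in> UU" "tdeg U = L"
  shows "Abs x L M \<Colon> \<langle>env_on E (fv (Abs x L M)) \<turnstile> Arrow U T\<rangle>"
proof (cases "(x, L) \<in> fv M")
  case True
  then show ?thesis
    using M T by (auto simp: env_on_fun_upd env_on_apply fv_Abs intro!: typing.arrI)
next
  case False
  then have eq: "env_on (E((x, L) := U)) (fv M) = env_on E (fv (Abs x L M))"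
    by (auto simp: env_on_apply fv_Abs)
  then have "Abs x L M \<Colon> \<langle>env_on E (fv (Abs x L M)) \<turnstile> Arrow (Omega L) T\<rangle>"
    using typing.arrI'[OF M[unfolded eq] _ T] by (simp add: fv_Abs)
  then show ?thesis
  proof (rule typing_sub_env_on)
    show "Arrow (Omega L) T \<sqsubseteq> Arrow U T"
      using sub_Omega[OF U(1)] U(2) T by (auto intro: sub.arrow sub.refl TT_UU.TT_UU)
    show "E v \<sqsubseteq> E v" if "v \<in> fv (Abs x L M)" for v
      using typing_env_SomeD[OF M, of "fst v" "snd v"] False that
      by (auto simp: env_on_apply fv_Abs split: if_splits intro: sub.refl)
  qed
qed

theorem ttyping_sound:
  fixes E :: "('v::infinite, 'a) tenv"
  assumes "E \<tturnstile> M \<Colon> U"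
  shows "M \<Colon> \<langle>env_on E (fv M) \<turnstile> U\<rangle>"
  using assms
proof (induction rule: ttyping.induct)
  case (var E x)
  have "env_on E {(x, [])} = [(x, []) \<mapsto> E (x, [])]" by (auto simp: env_on_apply)
  then show ?case using typing.ax[OF var(2), of x] by (simp del: fun_upd_apply)
next
  case (omega E M)
  then show ?case by (rule typing_omega_env_on)
next
  case (lam E U L T C M)
  obtain y where y: "y \<notin> C \<union> fst ` fv M" using arb_element[of "C \<union> fst ` fv M"] lam.hyps(5) by auto
  then have "Abs y L (open_var 0 y L M) \<Colon>
      \<langle>env_on E (fv (Abs y L (open_var 0 y L M))) \<turnstile> Arrow U T\<rangle>"
    using lam.IH lam.hyps(2-4) by (intro typing_Abs_env_on) (simp_all del: fun_upd_apply)
  moreover have "(y, L) \<notin> fv M" using y by force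
  ultimately show ?case by (simp add: Abs_open_var)
next
  case (app E M U T N)
  have "App M N \<Colon> \<langle>env_inter (env_on E (fv M)) (env_on E (fv N)) \<turnstile> T\<rangle>"
    using app.IH app.hyps ttyping_UU by (intro typing.arrE) auto
  then show ?case by (simp add: env_inter_env_on)
next
  case (exp E M U j)
  then show ?case by (auto simp: fv_lift simp flip: env_exp_env_on intro: typing.exp)
next
  case (sub E M U E' U')
  then show ?case using typing_sub_env_on by blast
qed (auto intro: typing.interI)

lemma ttyping_Var_TT:
  assumes "wf_tenv E" "T \<in> TT" "E (x, []) \<sqsubseteq> T"
  shows "E \<tturnstile> Var x [] \<Colon> T"
proof (rule ttyping.sub)
  have "wf_tenv (E((x, []) := T))"
    using assms by (intro wf_tenv_fun_upd) (auto simp: tdeg_TT intro: TT_UU.TT_UU)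
  then show "E((x, []) := T) \<tturnstile> Var x [] \<Colon> T"
    using ttyping.var[of "E((x, []) := T)" x] assms(2) by simp
  show "E v \<sqsubseteq> (E((x, []) := T)) v" for v using assms by (auto simp: wf_tenv_sub_refl)
  show "T \<sqsubseteq> T" using assms(2) by (intro sub.refl TT_UU.TT_UU)
qed

lemma ttyping_lift_total_env:
  fixes E :: "('v::infinite, 'a) tenv"
  assumes "total_env \<Gamma> \<tturnstile> M \<Colon> U" "wf_tenv E" "tenv_le E (env_exp j \<Gamma>)"
  shows "E \<tturnstile> lift j M \<Colon> Exp j U"
proof (rule ttyping.sub)
  show "tenv_exp j (total_env \<Gamma>) \<tturnstile> lift j M \<Colon> Exp j U" using assms(1) by (rule ttyping.exp)
  show "E v \<sqsubseteq> tenv_exp j (total_env \<Gamma>) v" for v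
    unfolding tenv_exp_total_env using assms(2,3) by (rule tenv_le_imp_sub_total_env)
  show "Exp j U \<sqsubseteq> Exp j U" using ttyping_UU[OF assms(1)] by (intro sub.refl TT_UU.exp)
qed

theorem ttyping_complete:
  fixes E :: "('v::infinite, 'a) tenv"
  assumes "M \<Colon> \<langle>\<Gamma> \<turnstile> U\<rangle>" "wf_tenv E" "tenv_le E \<Gamma>"
  shows "E \<tturnstile> M \<Colon> U"
  using assms
proof (induction arbitrary: E rule: typing.induct)
  case (ax T x)
  then show "E \<tturnstile> Var x [] \<Colon> T" by (intro ttyping_Var_TT) (auto intro: tenv_leD)
next
  case (omega M)
  then show ?case by (intro ttyping.omega)
next
  case (arrI M \<Gamma> x L U T)
  have U: "U \<in> UU" "tdeg U = L" using typing_env_SomeD[OF arrI.hyps(1), of x L U] by simp_all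
  then have "tenv_le (E((x, L) := U)) (\<Gamma>((x, L) \<mapsto> U))" using arrI.prems by (intro tenv_le_fun_upd)
  with arrI.prems(1) show ?case
    using U arrI.hyps(3) typing_dom[OF arrI.hyps(1)] arrI.IH by (rule ttyping_AbsI)
next
  case (arrI' M \<Gamma> T x L)
  have "tenv_le (E((x, L) := Omega L)) \<Gamma>"
    using arrI'.prems(2) by (rule tenv_le_cong) (use arrI'.hyps(2) in auto)
  with arrI'.prems(1) show ?case
    using TT_UU.omega tdeg_simps(3) arrI'.hyps(3) typing_dom[OF arrI'.hyps(1)] arrI'.IH
    by (rule ttyping_AbsI)
next
  case (arrE M\<^sub>1 \<Gamma>\<^sub>1 U T M\<^sub>2 \<Gamma>\<^sub>2)
  note le = tenv_le_env_inter[OF arrE.prems(2) arrE.hyps(1,2)]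
  have "M\<^sub>1 \<diamondop> M\<^sub>2"
    using arrE.hyps(3) typing_dom[OF arrE.hyps(1)] typing_dom[OF arrE.hyps(2)] by simp
  then show ?case using arrE.IH le arrE.prems(1) arrE.hyps(5) by (intro ttyping.app)
next
  case (interI M \<Gamma> U\<^sub>1 U\<^sub>2)
  then show ?case by (blast intro: ttyping.inter)
next
  case (exp M \<Gamma> U j)
  have "total_env \<Gamma> \<tturnstile> M \<Colon> U" using exp.hyps exp.IH wf_tenv_total_env tenv_le_total_env by blast
  then show ?case using exp.prems by (rule ttyping_lift_total_env)
next
  case (sub M \<Gamma> U \<Gamma>' U')
  have "E \<tturnstile> M \<Colon> U" using sub.IH sub.prems tenv_le_sub_typing[OF _ sub.hyps(2)] by blast
  then show ?case
    using sub_typingD[OF sub.hyps(2)] sub.prems(1) by (auto intro: ttyping.sub wf_tenv_sub_refl)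
qed


subsection \<open>Derived typing rules\<close>

lemma ttyping_weaken:
  fixes E :: "('v::infinite, 'a) tenv"
  assumes "E \<tturnstile> M \<Colon> U" "wf_tenv E'" "\<And>v. v \<in> fv M \<Longrightarrow> E' v \<sqsubseteq> E v"
  shows "E' \<tturnstile> M \<Colon> U"
  using ttyping_sound[OF assms(1)] assms(2)
  by (rule ttyping_complete) (intro tenv_le_env_on assms(3))

lemma ttyping_Abs:
  fixes E :: "('v::infinite, 'a) tenv"
  assumes "wf_tenv E" "E((x, L) := U) \<tturnstile> M \<Colon> T" "T \<in> TT"
  shows "E \<tturnstile> Abs x L M \<Colon> Arrow U T"
proof -
  have wf: "wf_tenv (E((x, L) := U))" using assms(2) by (rule ttyping_wf_tenv)
  have "tenv_le (E((x, L) := U)) (env_on (E((x, L) := U)) (fv M))"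
    using wf_tenv_sub_refl[OF wf] by (rule tenv_le_env_on)
  with assms(1) show ?thesis
    using wf_tenv_fun_updD[OF wf] assms(3) dom_env_on
      ttyping_complete[OF ttyping_sound[OF assms(2)]]
    by (rule ttyping_AbsI)
qed

lemma typing_Var: "U \<in> UU \<Longrightarrow> Var x (tdeg U) \<Colon> \<langle>[(x, tdeg U) \<mapsto> U] \<turnstile> U\<rangle>"
proof (induction U rule: TT_UU.inducts(2)[where ?P1.0 = "\<lambda>_. True"])
  case (TT_UU T)
  then show ?case using typing.ax[of T x] by (simp add: tdeg_TT del: fun_upd_apply)
next
  case (omega L)
  show ?case
    using typing.omega[OF terms.var[of x L]] by (simp add: env_omega_Var del: fun_upd_apply)
next
  case (inter U V)
  have "Var x L \<Colon> \<langle>[(x, L) \<mapsto> W] \<turnstile> W'\<rangle>"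
    if "Var x L \<Colon> \<langle>[(x, L) \<mapsto> W'] \<turnstile> W'\<rangle>" "W \<sqsubseteq> W'" for L W W'
  proof -
    have "sub_env [(x, L) \<mapsto> W] [(x, L) \<mapsto> W']"
      using that(2) by (intro sub_env.decl) (auto simp: wf_env_def)
    then have "sub_typing ([(x, L) \<mapsto> W'], W') ([(x, L) \<mapsto> W], W')"
      using sub_imp_UU[OF that(2)] by (intro sub_typing.pair sub.refl) auto
    with that(1) show ?thesis by (rule typing.sub)
  qed
  then have "Var x (tdeg U) \<Colon> \<langle>[(x, tdeg U) \<mapsto> Inter U V] \<turnstile> U\<rangle>"
    "Var x (tdeg U) \<Colon> \<langle>[(x, tdeg U) \<mapsto> Inter U V] \<turnstile> V\<rangle>"
    using inter sub.inter_elim sub_inter_elim_right by metis+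
  then show ?case by (simp add: typing.interI del: fun_upd_apply)
next
  case (exp U i)
  have "env_exp i [(x, tdeg U) \<mapsto> U] = [(x, i # tdeg U) \<mapsto> Exp i U]"
    by (auto simp: env_exp_def fun_eq_iff split: list.splits)
  then show ?case using typing.exp[OF exp.IH, of i] by (simp del: fun_upd_apply)
qed auto

lemma ttyping_Var:
  fixes E :: "('v::infinite, 'a) tenv"
  assumes "wf_tenv E"
  shows "E \<tturnstile> Var x L \<Colon> E (x, L)"
  using typing_Var[of "E (x, L)" x] assms
  by (intro ttyping_complete[of _ "[(x, L) \<mapsto> E (x, L)]"])
    (auto simp: wf_tenvD wf_tenv_sub_refl intro!: tenv_leI split: if_splits)


section \<open>Subject expansion\<close>

definition subst_splits ::
  "('v, 'a) tenv \<Rightarrow> 'a ty \<Rightarrow> 'v \<Rightarrow> index \<Rightarrow> 'v trm \<Rightarrow> 'v trm \<Rightarrow> bool" where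
  "subst_splits E U x L N M \<longleftrightarrow> (\<exists>V. E((x, L) := V) \<tturnstile> M \<Colon> U \<and> E \<tturnstile> N \<Colon> V)"

lemma subst_splitsI: "\<lbrakk>E((x, L) := V) \<tturnstile> M \<Colon> U; E \<tturnstile> N \<Colon> V\<rbrakk> \<Longrightarrow> subst_splits E U x L N M"
  unfolding subst_splits_def by blast

lemma subst_splitsE:
  assumes "subst_splits E U x L N M"
  obtains V where "E((x, L) := V) \<tturnstile> M \<Colon> U" "E \<tturnstile> N \<Colon> V"
  using assms unfolding subst_splits_def by blast

lemma subst_splits_fresh:
  fixes E :: "('v::infinite, 'a) tenv"
  assumes "E \<tturnstile> M \<Colon> U" "(x, L) \<notin> fv M" "N \<in> terms" "deg N = L"
  shows "subst_splits E U x L N M"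
proof (rule subst_splitsI)
  have wf: "wf_tenv E" using assms(1) by (rule ttyping_wf_tenv)
  then show "E \<tturnstile> N \<Colon> Omega L" using ttyping.omega[OF _ assms(3)] assms(4) by simp
  have "wf_tenv (E((x, L) := Omega L))" using wf TT_UU.omega by (rule wf_tenv_fun_upd) simp
  with assms(1) show "E((x, L) := Omega L) \<tturnstile> M \<Colon> U"
    by (rule ttyping_weaken) (use assms(2) wf in \<open>auto simp: wf_tenv_sub_refl\<close>)
qed

lemma subst_splits_Var:
  fixes E :: "('v::infinite, 'a) tenv"
  assumes "E \<tturnstile> subst x L N (Var y K) \<Colon> U" "N \<in> terms" "deg N = L"
  shows "subst_splits E U x L N (Var y K)"
proof (cases "(y, K) = (x, L)")
  case True
  then have N: "E \<tturnstile> N \<Colon> U" using assms(1) by simp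
  then have "wf_tenv (E((x, L) := U))"
    using assms(3) ttyping_wf_tenv ttyping_UU ttyping_tdeg by (metis wf_tenv_fun_upd)
  then have "E((x, L) := U) \<tturnstile> Var x L \<Colon> U" using ttyping_Var by (metis fun_upd_same)
  then have "subst_splits E U x L N (Var x L)" using N by (rule subst_splitsI)
  then show ?thesis using True by simp
next
  case False
  then show ?thesis using assms by (intro subst_splits_fresh) auto
qed

lemma subst_splits_omega:
  fixes E :: "('v::infinite, 'a) tenv"
  assumes "wf_tenv E" "M \<in> terms" "N \<in> terms" "deg N = L"
  shows "subst_splits E (Omega (deg M)) x L N M"
proof (rule subst_splitsI)
  have "wf_tenv (E((x, L) := Omega L))" using assms(1) TT_UU.omega by (rule wf_tenv_fun_upd) simp
  then show "E((x, L) := Omega L) \<tturnstile> M \<Colon> Omega (deg M)" using assms(2) by (rule ttyping.omega)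
  show "E \<tturnstile> N \<Colon> Omega L" using ttyping.omega[OF assms(1,3)] assms(4) by simp
qed

lemma subst_splits_Lam:
  fixes E :: "('v::infinite, 'a) tenv"
  assumes split: "\<And>y. y \<notin> C \<Longrightarrow> subst_splits (E((y, K) := U)) T x L N (open_var 0 y K M)"
    and "finite C" "wf_tenv E" "T \<in> TT" "deg N = L"
  shows "subst_splits E (Arrow U T) x L N (Lam K M)"
proof -
  have "finite (insert x (C \<union> fst ` (fv M \<union> fv N)))" using assms(2) by simp
  then obtain y where y: "y \<notin> insert x (C \<union> fst ` (fv M \<union> fv N))" using arb_element by blast
  then have fresh: "(y, K) \<notin> fv M" "(y, K) \<notin> fv N" by force+
  obtain V where M: "E((y, K) := U, (x, L) := V) \<tturnstile> open_var 0 y K M \<Colon> T"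
    and N: "E((y, K) := U) \<tturnstile> N \<Colon> V"
    using split[of y] y by (auto elim: subst_splitsE)
  have N': "E \<tturnstile> N \<Colon> V"
    using N assms(3)
    by (rule ttyping_weaken) (use assms(3) fresh(2) in \<open>auto simp: wf_tenv_sub_refl\<close>)
  have "E((x, L) := V, (y, K) := U) \<tturnstile> open_var 0 y K M \<Colon> T"
    using M y by (simp add: fun_upd_twist)
  then have "E((x, L) := V) \<tturnstile> Abs y K (open_var 0 y K M) \<Colon> Arrow U T"
    using ttyping_UU[OF N'] ttyping_tdeg[OF N'] assms(3-5)
    by (intro ttyping_Abs wf_tenv_fun_upd) auto
  then have "E((x, L) := V) \<tturnstile> Lam K M \<Colon> Arrow U T" using fresh(1) by (simp add: Abs_open_var)
  then show ?thesis using N' by (rule subst_splitsI)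
qed

lemma subst_splits_common_type:
  fixes E :: "('v::infinite, 'a) tenv"
  assumes "subst_splits E U\<^sub>1 x L N M\<^sub>1" "subst_splits E U\<^sub>2 x L N M\<^sub>2"
  obtains V where "E((x, L) := V) \<tturnstile> M\<^sub>1 \<Colon> U\<^sub>1" "E((x, L) := V) \<tturnstile> M\<^sub>2 \<Colon> U\<^sub>2" "E \<tturnstile> N \<Colon> V"
proof -
  obtain V\<^sub>1 V\<^sub>2 where M: "E((x, L) := V\<^sub>1) \<tturnstile> M\<^sub>1 \<Colon> U\<^sub>1" "E((x, L) := V\<^sub>2) \<tturnstile> M\<^sub>2 \<Colon> U\<^sub>2"
    and N: "E \<tturnstile> N \<Colon> V\<^sub>1" "E \<tturnstile> N \<Colon> V\<^sub>2"
    using assms unfolding subst_splits_def by blast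
  have V: "V\<^sub>1 \<in> UU" "V\<^sub>2 \<in> UU" "tdeg V\<^sub>1 = tdeg V\<^sub>2"
    using N ttyping_UU ttyping_tdeg by metis+
  have E: "E v \<sqsubseteq> E v" for v using ttyping_wf_tenv[OF N(1)] by (rule wf_tenv_sub_refl)
  have "E((x, L) := Inter V\<^sub>1 V\<^sub>2) \<tturnstile> M\<^sub>1 \<Colon> U\<^sub>1"
    using M(1)
    by (rule ttyping.sub) (auto simp: E V sub.inter_elim sub.refl ttyping_UU[OF M(1)])
  moreover have "E((x, L) := Inter V\<^sub>1 V\<^sub>2) \<tturnstile> M\<^sub>2 \<Colon> U\<^sub>2"
    using M(2)
    by (rule ttyping.sub) (auto simp: E V sub_inter_elim_right sub.refl ttyping_UU[OF M(2)])
  moreover have "E \<tturnstile> N \<Colon> Inter V\<^sub>1 V\<^sub>2" using N by (rule ttyping.inter)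
  ultimately show thesis by (rule that)
qed

lemma subst_splits_App:
  fixes E :: "('v::infinite, 'a) tenv"
  assumes "subst_splits E (Arrow U T) x L N M\<^sub>1" "subst_splits E U x L N M\<^sub>2" "M\<^sub>1 \<diamondop> M\<^sub>2" "T \<in> TT"
  shows "subst_splits E T x L N (App M\<^sub>1 M\<^sub>2)"
  using assms(1,2)
  by (rule subst_splits_common_type) (blast intro: subst_splitsI ttyping.app assms(3,4))

lemma subst_splits_Inter:
  fixes E :: "('v::infinite, 'a) tenv"
  assumes "subst_splits E U\<^sub>1 x L N M" "subst_splits E U\<^sub>2 x L N M"
  shows "subst_splits E (Inter U\<^sub>1 U\<^sub>2) x L N M"
  using assms by (rule subst_splits_common_type) (blast intro: subst_splitsI ttyping.inter)

lemma subst_splits_lift: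
  assumes "subst_splits E U x L N M"
  shows "subst_splits (tenv_exp j E) (Exp j U) x (j # L) (lift j N) (lift j M)"
  using assms by (rule subst_splitsE)
    (metis subst_splitsI tenv_exp_fun_upd ttyping.exp)

lemma subst_splits_sub:
  fixes E :: "('v::infinite, 'a) tenv"
  assumes "subst_splits E U x L N M" "\<And>v. E' v \<sqsubseteq> E v" "U \<sqsubseteq> U'"
  shows "subst_splits E' U' x L N M"
  using assms(1)
proof (rule subst_splitsE)
  fix V assume V: "E((x, L) := V) \<tturnstile> M \<Colon> U" "E \<tturnstile> N \<Colon> V"
  note refl = sub.refl[OF ttyping_UU[OF V(2)]]
  have "E'((x, L) := V) \<tturnstile> M \<Colon> U'"
    using V(1) _ assms(3) by (rule ttyping.sub) (simp add: refl assms(2))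
  moreover have "E' \<tturnstile> N \<Colon> V" using V(2) assms(2) refl by (rule ttyping.sub)
  ultimately show ?thesis by (rule subst_splitsI)
qed

lemma lift_eq_substE:
  assumes "lift j P = subst x L N M" "M \<in> terms" "N \<in> terms" "deg N = L" "(x, L) \<in> fv M"
  obtains L' M' N' where "L = j # L'" "M = lift j M'" "N = lift j N'" "P = subst x L' N' M'"
proof -
  have deg: "deg M = j # deg P" using assms(1,4) by (metis deg_lift deg_subst)
  then obtain M' where M: "M = lift j M'" using terms_deg_Cons[OF assms(2)] by blast
  obtain L' where L: "L = j # L'"
    using terms_prefix_deg[OF assms(2,5)] deg by (auto simp: prefix_def)
  then obtain N' where N: "N = lift j N'" using terms_deg_Cons[OF assms(3)] assms(4) by blast
  have "P = subst x L' N' M'" using assms(1) by (simp add: M N L subst_lift)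
  with L M N show thesis by (rule that)
qed

lemma ttyping_Lam_subst_splits:
  fixes E :: "('v::infinite, 'a) tenv"
  assumes "E \<tturnstile> subst x L N M \<Colon> Arrow U T" "Lam K P = subst x L N M"
    and terms: "M \<in> terms" "N \<in> terms" "M \<diamondop> N" "deg N = L" and "T \<in> TT" "finite C"
    and IH: "\<And>y M. \<lbrakk>y \<notin> C; open_var 0 y K P = subst x L N M; M \<in> terms; M \<diamondop> N\<rbrakk>
      \<Longrightarrow> subst_splits (E((y, K) := U)) T x L N M"
  shows "subst_splits E (Arrow U T) x L N M"
proof (cases M)
  case (Var z J)
  show ?thesis using assms(1) terms(2,4) unfolding Var by (rule subst_splits_Var)
next
  case (Lam J M')
  with assms(2) have M: "M = Lam K M'" and P: "P = subst x L N M'" by simp_all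
  show ?thesis
    unfolding M
  proof (rule subst_splits_Lam)
    fix y assume y: "y \<notin> insert x (C \<union> fst ` (fv M' \<union> fv N))"
    show "subst_splits (E((y, K) := U)) T x L N (open_var 0 y K M')"
    proof (rule IH)
      show "open_var 0 y K P = subst x L N (open_var 0 y K M')"
        using y terms_locally_closed[OF terms(2)] by (simp add: P subst_open_var)
      show "open_var 0 y K M' \<in> terms"
        using terms(1) y unfolding M by (intro terms_open_var) auto
      show "open_var 0 y K M' \<diamondop> N"
        using terms(3) y unfolding M by (intro joinable_open_var) auto
    qed (use y in simp)
  qed (use assms(7,8) terms(4) ttyping_wf_tenv[OF assms(1)] in auto)
qed (use assms(2) in simp_all)

lemma ttyping_App_subst_splits:
  fixes E :: "('v::infinite, 'a) tenv"
  assumes "E \<tturnstile> subst x L N M \<Colon> T" "App P\<^sub>1 P\<^sub>2 = subst x L N M"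
    and terms: "M \<in> terms" "N \<in> terms" "M \<diamondop> N" "deg N = L" and "T \<in> TT"
    and IH: "\<And>M. \<lbrakk>P\<^sub>1 = subst x L N M; M \<in> terms; M \<diamondop> N\<rbrakk> \<Longrightarrow> subst_splits E (Arrow U T) x L N M"
      "\<And>M. \<lbrakk>P\<^sub>2 = subst x L N M; M \<in> terms; M \<diamondop> N\<rbrakk> \<Longrightarrow> subst_splits E U x L N M"
  shows "subst_splits E T x L N M"
proof (cases M)
  case (Var z J)
  show ?thesis using assms(1) terms(2,4) unfolding Var by (rule subst_splits_Var)
next
  case (App M\<^sub>1 M\<^sub>2)
  note subterms = terms_AppD[OF terms(1)[unfolded App]]
  have "M\<^sub>1 \<diamondop> N" "M\<^sub>2 \<diamondop> N" using terms(3) by (auto simp: App intro: joinable_mono)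
  then have "subst_splits E (Arrow U T) x L N M\<^sub>1" "subst_splits E U x L N M\<^sub>2"
    using assms(2) subterms(1,2) by (simp_all add: App IH)
  then show ?thesis unfolding App using subterms(4) assms(7) by (rule subst_splits_App)
qed (use assms(2) in simp_all)

theorem ttyping_subst_splits:
  fixes E :: "('v::infinite, 'a) tenv"
  assumes "E \<tturnstile> subst x L N M \<Colon> U" "M \<in> terms" "N \<in> terms" "M \<diamondop> N" "deg N = L"
  shows "subst_splits E U x L N M"
  using assms
proof (induction E "subst x L N M" U arbitrary: x L N M rule: ttyping.induct)
  case (var E y)
  have typed: "E \<tturnstile> subst x L N M \<Colon> E (y, [])" using ttyping.var[OF var(1,2)] var(3) by simp
  show ?case
  proof (cases M)
    case (Var z K)
    show ?thesis using typed var.prems(2,4) unfolding Var by (rule subst_splits_Var)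
  qed (use var(3) in simp_all)
next
  case (omega E)
  then show ?case by (simp add: deg_subst subst_splits_omega)
next
  case (lam E U K T C P)
  have "E \<tturnstile> subst x L N M \<Colon> Arrow U T" using ttyping.lam[OF lam.hyps(1-6)] lam.hyps(8) by simp
  then show ?case using lam.hyps(8) lam.prems lam.hyps(4,5)
    by (rule ttyping_Lam_subst_splits) (use lam.hyps(7) lam.prems(2,4) in blast)
next
  case (app E P\<^sub>1 U T P\<^sub>2)
  have "E \<tturnstile> subst x L N M \<Colon> T" using ttyping.app[OF app.hyps(1,3,5,6)] app.hyps(7) by simp
  then show ?case using app.hyps(7) app.prems app.hyps(6)
    by (rule ttyping_App_subst_splits) (use app.hyps(2,4) app.prems(2,4) in blast)+
next
  case (inter E U\<^sub>1 U\<^sub>2)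
  then show ?case by (intro subst_splits_Inter) blast+
next
  case (exp E P U j)
  show ?case
  proof (cases "(x, L) \<in> fv M")
    case True
    with exp.hyps(3) exp.prems obtain L' M' N'
      where lift: "L = j # L'" "M = lift j M'" "N = lift j N'" "P = subst x L' N' M'"
      by (metis lift_eq_substE)
    then have "subst_splits E U x L' N' M'"
      using exp.hyps(2) exp.prems by (simp add: fv_lift joinable_lift)
    then show ?thesis unfolding lift(1-3) by (rule subst_splits_lift)
  next
    case False
    then have "tenv_exp j E \<tturnstile> M \<Colon> Exp j U"
      using ttyping.exp[OF exp.hyps(1), of j] exp.hyps(3) by (simp add: subst_fresh)
    then show ?thesis using False exp.prems(2,4) by (rule subst_splits_fresh)
  qed
next
  case (sub E U E' U')
  then show ?case by (blast intro: subst_splits_sub)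
qed

lemma ttyping_redex_expansion:
  fixes E :: "('v::infinite, 'a) tenv"
  assumes "E \<tturnstile> subst x L N M \<Colon> T" "T \<in> TT" "M \<in> terms" "N \<in> terms" "deg N = L" "M \<diamondop> N"
    and "App (Abs x L M) N \<in> terms"
  shows "E \<tturnstile> App (Abs x L M) N \<Colon> T"
  using ttyping_subst_splits[OF assms(1,3,4,6,5)]
proof (rule subst_splitsE)
  fix V assume "E((x, L) := V) \<tturnstile> M \<Colon> T" and N: "E \<tturnstile> N \<Colon> V"
  then have "E \<tturnstile> Abs x L M \<Colon> Arrow V T"
    using ttyping_wf_tenv[OF assms(1)] assms(2) by (intro ttyping_Abs)
  then show ?thesis using N terms_AppD(4)[OF assms(7)] assms(2) by (rule ttyping.app)
qed

lemma ttyping_Lam_expansion: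
  fixes E :: "('v::infinite, 'a) tenv"
  assumes "M \<rhd>\<^sub>\<beta> Lam L P" "wf_tenv E" "U \<in> UU" "tdeg U = L" "T \<in> TT" "finite C"
    and P: "\<And>y. y \<notin> C \<Longrightarrow> E((y, L) := U) \<tturnstile> open_var 0 y L P \<Colon> T"
    and IH: "\<And>y M. \<lbrakk>y \<notin> C; M \<rhd>\<^sub>\<beta> open_var 0 y L P\<rbrakk> \<Longrightarrow> E((y, L) := U) \<tturnstile> M \<Colon> T"
  shows "E \<tturnstile> M \<Colon> Arrow U T"
  using assms(1)
proof (cases rule: beta_Lam_cases)
  case (redex x K M' N)
  then show ?thesis
    using ttyping_redex_expansion[of E x K N M' "Arrow U T"] ttyping.lam[OF assms(2-6) P]
      TT_UU.arrow[OF assms(3,5)] by simp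
next
  case (abs M')
  show ?thesis
    unfolding abs(1) using assms(2-5)
  proof (rule ttyping.lam)
    show "finite (C \<union> fst ` fv M')" using assms(6) by simp
    show "E((y, L) := U) \<tturnstile> open_var 0 y L M' \<Colon> T" if "y \<notin> C \<union> fst ` fv M'" for y
      using that abs(2) by (intro IH) auto
  qed
qed

lemma ttyping_App_expansion:
  fixes E :: "('v::infinite, 'a) tenv"
  assumes "M \<rhd>\<^sub>\<beta> App P\<^sub>1 P\<^sub>2" "E \<tturnstile> P\<^sub>1 \<Colon> Arrow U T" "E \<tturnstile> P\<^sub>2 \<Colon> U" "P\<^sub>1 \<diamondop> P\<^sub>2" "T \<in> TT"
    and IH: "\<And>M. M \<rhd>\<^sub>\<beta> P\<^sub>1 \<Longrightarrow> E \<tturnstile> M \<Colon> Arrow U T" "\<And>M. M \<rhd>\<^sub>\<beta> P\<^sub>2 \<Longrightarrow> E \<tturnstile> M \<Colon> U"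
  shows "E \<tturnstile> M \<Colon> T"
  using assms(1)
proof (cases rule: beta.cases)
  case (redex M' N x L)
  then show ?thesis
    using ttyping_redex_expansion[of E x L N M' T] ttyping.app[OF assms(2-5)] assms(5) by simp
next
  case (appL M\<^sub>1)
  then have "M\<^sub>1 \<diamondop> P\<^sub>2" using terms_AppD(4) by blast
  then show ?thesis using appL IH(1) assms(3,5) by (auto intro: ttyping.app)
next
  case (appR M\<^sub>2)
  then have "P\<^sub>1 \<diamondop> M\<^sub>2" using terms_AppD(4) by blast
  then show ?thesis using appR IH(2) assms(2,5) by (auto intro: ttyping.app)
qed (simp add: Abs_def)

theorem ttyping_beta_expansion:
  fixes E :: "('v::infinite, 'a) tenv"
  assumes "E \<tturnstile> P \<Colon> U" "M \<rhd>\<^sub>\<beta> P"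
  shows "E \<tturnstile> M \<Colon> U"
  using assms
proof (induction arbitrary: M rule: ttyping.induct)
  case (var E x)
  from var(3) show ?case
  proof (cases rule: beta.cases)
    case (redex M' N y L)
    then show ?thesis
      using ttyping_redex_expansion[of E y L N M'] ttyping.var[OF var(1,2)] var(2) by simp
  qed (simp_all add: Abs_def)
next
  case (omega E P)
  then show ?case using ttyping.omega[OF omega(1) beta_terms[of M P]] beta_deg[of M P] by simp
next
  case (lam E U L T C P)
  then show ?case by (blast intro: ttyping_Lam_expansion)
next
  case (app E P\<^sub>1 U T P\<^sub>2)
  then show ?case by (blast intro: ttyping_App_expansion)
next
  case (inter E P U\<^sub>1 U\<^sub>2)
  then show ?case by (blast intro: ttyping.inter)
next
  case (exp E P U j)
  have "deg M = j # deg P" using beta_deg[OF exp.prems] by simp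
  then obtain M' where M: "M = lift j M'"
    using terms_deg_Cons[OF beta_terms[OF exp.prems]] by blast
  then have "M' \<rhd>\<^sub>\<beta> P" using exp.prems beta_liftD by blast
  then show ?case unfolding M by (intro ttyping.exp exp.IH)
next
  case (sub E P U E' U')
  then show ?case by (blast intro: ttyping.sub)
qed

corollary ttyping_betas_expansion:
  fixes E :: "('v::infinite, 'a) tenv"
  assumes "M \<rhd>\<^sub>\<beta>\<^sup>* P" "E \<tturnstile> P \<Colon> U"
  shows "E \<tturnstile> M \<Colon> U"
  using assms by (induction rule: converse_rtranclp_induct) (auto intro: ttyping_beta_expansion)

theorem theorem5:
  fixes M N :: "'v::{countable,infinite} trm"
    and \<Gamma> :: "('v, 'a) env"
    and U :: "'a ty"
  assumes "N \<Colon> \<langle>\<Gamma> \<turnstile> U\<rangle>"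
    and "M \<rhd>\<^sub>\<beta>\<^sup>* N"
  shows "M \<Colon> \<langle>env_up \<Gamma> M \<turnstile> U\<rangle>"
proof -
  have "total_env \<Gamma> \<tturnstile> N \<Colon> U"
    using assms(1) wf_tenv_total_env tenv_le_total_env by (intro ttyping_complete)
  with assms(2) have "total_env \<Gamma> \<tturnstile> M \<Colon> U" by (rule ttyping_betas_expansion)
  then have "M \<Colon> \<langle>env_on (total_env \<Gamma>) (fv M) \<turnstile> U\<rangle>" by (rule ttyping_sound)
  moreover have "dom \<Gamma> \<subseteq> fv M" using typing_dom[OF assms(1)] betas_fv[OF assms(2)] by simp
  ultimately show ?thesis by (simp add: env_on_total_env)
qed

end
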